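(* Let $u$ be a strict preference-potential game, and let $p_1,\dots,p_m$ be its pure Nash equilibria. Then the sink chain components of the replicator flow of $u$ are exactly the singletons $\{p_1\},\dots,\{p_m\}$.
   Context: Games. A (finite) game has players $1,\dots,N$, finite non-empty strategy sets $S_1,\dots,S_N$ and a utility function $u:Z\to\mathbb{R}^N$, where $Z=\prod_{i=1}^N S_i$ is the set of (pure) profiles. Two profiles are $i$-comparable if they differ exactly in the strategy of player $i$. A game is strict if $u_i(p)\neq u_i(q)$ for all $i$ and all $i$-comparable $p,q$. A pure Nash equilibrium is a profile $p$ with $u_i(q)\le u_i(p)$ for every $i$ and every $q$ that is $i$-comparable to $p$. The response graph is the directed graph with node set $Z$ and an arc $p\to q$ if and only if $p,q$ are $i$-comparable for some $i$ and $u_i(p)\le u_i(q)$. A potential game is a game for which there is $P:Z\to\mathbb{R}$ with $u_i(p)-u_i(q)=P(p)-P(q)$ for all $i$ and all $i$-comparable $p,q$. A game is preference-potential if its response graph is isomorphic (as a directed graph) to the response graph of a potential game. The strategy space is $X=\prod_{i=1}^N\Delta_{|S_i|}$, where $\Delta_{|S_i|}$ is the simplex of probability distributions on $S_i$. For $x\in X$, $x^i_s$ is the probability player $i$ gives to $s\in S_i$. Pure profiles are identified with vertices of $X$. The expected utility is $\mathbb{U}(x)=\sum_{q\in Z}u(q)\prod_{i=1}^N x^i_{q_i}$, and $\mathbb{U}_p(s;\bar x_{-p})$ denotes player $p$'s expected utility when $p$ plays $s$ and the others play according to $x$. Replicator flow. The replicator flow $\phi:X\times\mathbb{R}\to X$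 is the flow of the ODE $\dot x^p_s=x^p_s\bigl(\mathbb{U}_p(s;\bar x_{-p})-\sum_{t\in S_p}x^p_t\,\mathbb{U}_p(t;\bar x_{-p})\bigr)$. Chains. Let $\mathbf{d}$ be the Euclidean metric on $X$. For $\epsilon,T>0$, an $(\epsilon,T)$-chain from $x$ to $y$ is a finite sequence $x=x_1,x_2,\dots,x_n=y$ with $n\ge 2$ and times $t_1,\dots,t_{n-1}\ge T$ such that $\mathbf{d}(\phi(x_i,t_i),x_{i+1})<\epsilon$ for $1\le i\le n-1$. There is a pseudo-orbit from $x$ to $y$ if there is an $(\epsilon,T)$-chain from $x$ to $y$ for all $\epsilon>0$ and $T>0$. Points $x,y$ are chain equivalent if there are pseudo-orbits from $x$ to $y$ and from $y$ to $x$; $x$ is chain recurrent if it is chain equivalent to itself. Chain equivalence is an equivalence relation on the chain recurrent points; its classes are the chain components. Pseudo-orbits induce a partial order on chain components; a sink chain component is a minimal one, i.e. a chain component $C$ such that whenever $c\in C$, $z$ is chain recurrent and there is a pseudo-orbit from $c$ to $z$, then $z\in C$. *)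

theory Defs
  imports "HOL-Analysis.Analysis" "Graph_Theory.Digraph_Isomorphism"
begin

section \<open>Finite games\<close>

text \<open>\<open>utility G q i\<close> is the utility of player \<open>i\<close> at the pure profile \<open>q\<close>. The set of players is a
  field of the record, rather than a type, so that the existential quantifier in
  \<open>preference_potential\<close> can range over games with an arbitrary number of players.\<close>

record ('i, 's) game =
  players :: "'i set"
  strategies :: "'i \<Rightarrow> 's set"
  utility :: "('i \<Rightarrow> 's) \<Rightarrow> 'i \<Rightarrow> real"

definition finite_game :: "('i, 's) game \<Rightarrow> bool" where
  "finite_game G \<longleftrightarrow> finite (players G) \<and> players G \<noteq> {} \<and>
     (\<forall>i\<in>players G. finite (strategies G i) \<and> strategies G i \<noteq> {})"

definition profiles :: "('i, 's) game \<Rightarrow> ('i \<Rightarrow> 's) set" where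
  "profiles G = (\<Pi>\<^sub>E i\<in>players G. strategies G i)"

definition comparable :: "('i, 's) game \<Rightarrow> 'i \<Rightarrow> ('i \<Rightarrow> 's) \<Rightarrow> ('i \<Rightarrow> 's) \<Rightarrow> bool" where
  "comparable G i p q \<longleftrightarrow> i \<in> players G \<and> p \<in> profiles G \<and> q \<in> profiles G \<and>
     p i \<noteq> q i \<and> (\<forall>j\<in>players G. j \<noteq> i \<longrightarrow> p j = q j)"

definition strict_game :: "('i, 's) game \<Rightarrow> bool" where
  "strict_game G \<longleftrightarrow> (\<forall>i p q. comparable G i p q \<longrightarrow> utility G p i \<noteq> utility G q i)"

definition pure_nash :: "('i, 's) game \<Rightarrow> ('i \<Rightarrow> 's) \<Rightarrow> bool" where
  "pure_nash G p \<longleftrightarrow> p \<in> profiles G \<and>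
     (\<forall>i q. comparable G i q p \<longrightarrow> utility G q i \<le> utility G p i)"

definition response_graph ::
    "('i, 's) game \<Rightarrow> ('i \<Rightarrow> 's, ('i \<Rightarrow> 's) \<times> ('i \<Rightarrow> 's)) pre_digraph" where
  "response_graph G =
     \<lparr> verts = profiles G,
       arcs = {(p, q). \<exists>i. comparable G i p q \<and> utility G p i \<le> utility G q i},
       tail = fst, head = snd \<rparr>"

definition potential_game :: "('i, 's) game \<Rightarrow> bool" where
  "potential_game G \<longleftrightarrow> finite_game G \<and>
     (\<exists>P :: ('i \<Rightarrow> 's) \<Rightarrow> real. \<forall>i p q. comparable G i p q \<longrightarrow>
        utility G p i - utility G q i = P p - P q)"

text \<open>The potential game is unrelated to \<open>G\<close> except through its response graph; in particular it may
  have different numbers of players and strategies. Naming its players and strategies by natural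
  numbers is no restriction, since it is finite.\<close>

definition preference_potential :: "('i, 's) game \<Rightarrow> bool" where
  "preference_potential G \<longleftrightarrow>
     (\<exists>H :: (nat, nat) game. potential_game H \<and> digraph_iso (response_graph G) (response_graph H))"


section \<open>Mixed profiles and the replicator flow\<close>

text \<open>A mixed profile is a vector \<open>x\<close> with \<open>x $ i $ s\<close> the probability that player \<open>i\<close> gives to \<open>s\<close>.
  The coordinates that belong to no player, or to no strategy of that player, are fixed to be \<open>0\<close>,
  so that the library metric of \<open>real^'s^'i\<close> restricts to the Euclidean metric on the product of
  simplices.\<close>

definition strategy_space :: "('i::finite, 's::finite) game \<Rightarrow> (real^'s^'i) set" where
  "strategy_space G = {x.
     (\<forall>i\<in>players G. (\<forall>s\<in>strategies G i. 0 \<le> x $ i $ s) \<and> (\<Sum>s\<in>strategies G i. x $ i $ s) = 1) \<and>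
     (\<forall>i s. i \<notin> players G \<or> s \<notin> strategies G i \<longrightarrow> x $ i $ s = 0)}"

definition pure_point :: "('i::finite, 's::finite) game \<Rightarrow> ('i \<Rightarrow> 's) \<Rightarrow> real^'s^'i" where
  "pure_point G p = (\<chi> i s. if i \<in> players G \<and> p i = s then 1 else 0)"

definition expected_utility :: "('i::finite, 's::finite) game \<Rightarrow> real^'s^'i \<Rightarrow> 'i \<Rightarrow> real" where
  "expected_utility G x i = (\<Sum>q\<in>profiles G. utility G q i * (\<Prod>j\<in>players G. x $ j $ (q j)))"

definition deviation_utility ::
    "('i::finite, 's::finite) game \<Rightarrow> 'i \<Rightarrow> 's \<Rightarrow> real^'s^'i \<Rightarrow> real" where
  "deviation_utility G i s x = expected_utility G (\<chi> j. if j = i then axis s 1 else x $ j) i"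

definition replicator_field :: "('i::finite, 's::finite) game \<Rightarrow> real^'s^'i \<Rightarrow> real^'s^'i" where
  "replicator_field G x = (\<chi> i s. x $ i $ s *
     (deviation_utility G i s x - (\<Sum>t\<in>strategies G i. x $ i $ t * deviation_utility G i t x)))"

text \<open>These conditions determine \<open>\<phi> x t\<close> for all \<open>x\<close> in the strategy space and all real \<open>t\<close>, because
  the replicator field is a polynomial map and so initial value problems have at most one solution.\<close>

definition replicator_flow ::
    "('i::finite, 's::finite) game \<Rightarrow> (real^'s^'i \<Rightarrow> real \<Rightarrow> real^'s^'i) \<Rightarrow> bool" where
  "replicator_flow G \<phi> \<longleftrightarrow> (\<forall>x\<in>strategy_space G. \<phi> x 0 = x \<and>
     (\<forall>t. \<phi> x t \<in> strategy_space G \<and>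
          (\<phi> x has_vector_derivative replicator_field G (\<phi> x t)) (at t)))"


section \<open>Chain components of a flow\<close>

definition chain ::
    "'a::metric_space set \<Rightarrow> ('a \<Rightarrow> real \<Rightarrow> 'a) \<Rightarrow> real \<Rightarrow> real \<Rightarrow> 'a \<Rightarrow> 'a \<Rightarrow> bool" where
  "chain X \<phi> \<epsilon> T x y \<longleftrightarrow> (\<exists>(n::nat) (xs :: nat \<Rightarrow> 'a) (ts :: nat \<Rightarrow> real).
     2 \<le> n \<and> xs 1 = x \<and> xs n = y \<and> (\<forall>i\<in>{1..n}. xs i \<in> X) \<and>
     (\<forall>i\<in>{1..<n}. T \<le> ts i \<and> dist (\<phi> (xs i) (ts i)) (xs (Suc i)) < \<epsilon>))"

definition pseudo_orbit ::
    "'a::metric_space set \<Rightarrow> ('a \<Rightarrow> real \<Rightarrow> 'a) \<Rightarrow> 'a \<Rightarrow> 'a \<Rightarrow> bool" where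
  "pseudo_orbit X \<phi> x y \<longleftrightarrow> (\<forall>\<epsilon>>0. \<forall>T>0. chain X \<phi> \<epsilon> T x y)"

definition chain_equivalent ::
    "'a::metric_space set \<Rightarrow> ('a \<Rightarrow> real \<Rightarrow> 'a) \<Rightarrow> 'a \<Rightarrow> 'a \<Rightarrow> bool" where
  "chain_equivalent X \<phi> x y \<longleftrightarrow> pseudo_orbit X \<phi> x y \<and> pseudo_orbit X \<phi> y x"

text \<open>Chains stay in \<open>X\<close>, so chain recurrent points lie in \<open>X\<close>.\<close>

definition chain_recurrent :: "'a::metric_space set \<Rightarrow> ('a \<Rightarrow> real \<Rightarrow> 'a) \<Rightarrow> 'a \<Rightarrow> bool" where
  "chain_recurrent X \<phi> x \<longleftrightarrow> chain_equivalent X \<phi> x x"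

definition chain_components :: "'a::metric_space set \<Rightarrow> ('a \<Rightarrow> real \<Rightarrow> 'a) \<Rightarrow> 'a set set" where
  "chain_components X \<phi> = {x. chain_recurrent X \<phi> x} //
     {(x, y). chain_recurrent X \<phi> x \<and> chain_recurrent X \<phi> y \<and> chain_equivalent X \<phi> x y}"

definition sink_chain_components :: "'a::metric_space set \<Rightarrow> ('a \<Rightarrow> real \<Rightarrow> 'a) \<Rightarrow> 'a set set" where
  "sink_chain_components X \<phi> = {C \<in> chain_components X \<phi>.
     \<forall>c\<in>C. \<forall>z. chain_recurrent X \<phi> z \<and> pseudo_orbit X \<phi> c z \<longrightarrow> z \<in> C}"

end

theory Submission
  imports Defs
begin

text \<open>
  A strict pure Nash equilibrium attracts a neighbourhood at an exponential rate, so no pseudo-orbit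
  leaves it. It remains to find a pseudo-orbit from every point of the strategy space to some pure
  equilibrium.

  First one reaches a pure profile, by induction on the support. In the relative interior of a face,
  the coordinates \<open>ln (x $ i $ s) - ln (x $ i $ b i)\<close> turn the replicator field into one whose
  every component is independent of its own coordinate; its flow therefore preserves Lebesgue
  measure, being a limit of compositions of shears. If the set of points of the face that are
  reachable by \<open>(\<epsilon>, T)\<close>-chains stayed away from the boundary of the face, it would have finite
  positive volume in these coordinates and its time-\<open>T\<close> image would omit an open part of it,
  contradicting volume preservation. So chains reach a smaller face.

  From pure profiles one follows arcs of the response graph, along which the replicator flow runs on
  an edge of the strategy space. A potential of the isomorphic game, transported to the given game,
  increases along these arcs, so the process ends at a pure equilibrium.
\<close>

section \<open>Flows that preserve Lebesgue measure\<close>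

text \<open>The right-hand side does not depend on \<open>k\<close>, so a shear can be compared with the identity
  \<open>k = 0\<close>.\<close>

lemma nn_integral_shear_fibres:
  fixes k :: "'a::euclidean_space \<Rightarrow> real" and f :: "'a \<Rightarrow> ennreal"
  assumes e: "e \<in> Basis" and k [measurable]: "k \<in> borel_measurable borel"
    and inv: "\<And>v r. k (v + r *\<^sub>R e) = k v"
    and f [measurable]: "f \<in> borel_measurable borel"
  shows "(\<integral>\<^sup>+ v. f (v + k v *\<^sub>R e) \<partial>lborel) =
    (\<integral>\<^sup>+ v. indicator {0..1} (v \<bullet> e) * (\<integral>\<^sup>+ s. f (v + s *\<^sub>R e) \<partial>lborel) \<partial>lborel)"
proof -
  \<comment> \<open>This weight enters as a factor 1, integrated over an auxiliary \<open>s\<close>.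
    After Fubini, translating \<open>v\<close> by \<open>- s *\<^sub>R e\<close> moves
    \<open>s\<close> into the shear, and substituting \<open>k v - s\<close> for \<open>s\<close>
    then removes \<open>k\<close>.\<close>
  have one: "(\<integral>\<^sup>+ s. indicator {0..1} (s + a) \<partial>lborel) = (1::ennreal)" for a :: real
  proof -
    have "(\<integral>\<^sup>+ s. indicator {0..1} (s + a) \<partial>lborel) = (\<integral>\<^sup>+ s. indicator {0..1::real} s \<partial>lborel)"
      using nn_integral_real_affine[of "indicator {0..1::real}" 1 a] by (simp add: add.commute)
    then show ?thesis by simp
  qed
  have "(\<integral>\<^sup>+ v. f (v + k v *\<^sub>R e) \<partial>lborel) =
      (\<integral>\<^sup>+ v. (\<integral>\<^sup>+ s. f (v + k v *\<^sub>R e) * indicator {0..1} (s + v \<bullet> e) \<partial>lborel) \<partial>lborel)"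
    by (simp add: nn_integral_cmult one)
  also have "\<dots> = (\<integral>\<^sup>+ s. (\<integral>\<^sup>+ v. f (v + k v *\<^sub>R e) * indicator {0..1} (s + v \<bullet> e) \<partial>lborel) \<partial>lborel)"
    by (intro lborel_pair.Fubini'[symmetric]) measurable
  also have "\<dots> = (\<integral>\<^sup>+ s. (\<integral>\<^sup>+ v. f (v + (k v - s) *\<^sub>R e) * indicator {0..1} (v \<bullet> e) \<partial>lborel) \<partial>lborel)"
  proof (rule nn_integral_cong)
    fix s :: real
    let ?h = "\<lambda>v. f (v + k v *\<^sub>R e) * indicator {0..1} (s + v \<bullet> e)"
    have "(\<integral>\<^sup>+ v. ?h v \<partial>lborel) = (\<integral>\<^sup>+ v. ?h v \<partial>distr lborel borel ((+) ((- s) *\<^sub>R e)))"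
      by (simp only: lborel_distr_plus)
    also have "\<dots> = (\<integral>\<^sup>+ v. ?h ((- s) *\<^sub>R e + v) \<partial>lborel)"
      by (intro nn_integral_distr) measurable
    also have "\<dots> = (\<integral>\<^sup>+ v. f (v + (k v - s) *\<^sub>R e) * indicator {0..1} (v \<bullet> e) \<partial>lborel)"
      using e inv[of _ "- s"]
      by (intro nn_integral_cong) (simp add: algebra_simps inner_simps)
    finally show "(\<integral>\<^sup>+ v. ?h v \<partial>lborel) =
        (\<integral>\<^sup>+ v. f (v + (k v - s) *\<^sub>R e) * indicator {0..1} (v \<bullet> e) \<partial>lborel)" .
  qed
  also have "\<dots> = (\<integral>\<^sup>+ v. (\<integral>\<^sup>+ s. f (v + (k v - s) *\<^sub>R e) * indicator {0..1} (v \<bullet> e) \<partial>lborel) \<partial>lborel)"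
    by (intro lborel_pair.Fubini') measurable
  also have "\<dots> = (\<integral>\<^sup>+ v. indicator {0..1} (v \<bullet> e) * (\<integral>\<^sup>+ s. f (v + s *\<^sub>R e) \<partial>lborel) \<partial>lborel)"
  proof (rule nn_integral_cong)
    fix v :: 'a
    show "(\<integral>\<^sup>+ s. f (v + (k v - s) *\<^sub>R e) * indicator {0..1} (v \<bullet> e) \<partial>lborel) =
        indicator {0..1} (v \<bullet> e) * (\<integral>\<^sup>+ s. f (v + s *\<^sub>R e) \<partial>lborel)"
      using nn_integral_real_affine[of "\<lambda>s. f (v + s *\<^sub>R e)" "-1" "k v"]
      by (simp add: nn_integral_cmult mult.commute)
  qed
  finally show ?thesis .
qed

lemma distr_shear_lborel:
  fixes k :: "'a::euclidean_space \<Rightarrow> real"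
  assumes e: "e \<in> Basis" and k [measurable]: "k \<in> borel_measurable borel"
    and inv: "\<And>v r. k (v + r *\<^sub>R e) = k v"
  shows "distr lborel lborel (\<lambda>v. v + k v *\<^sub>R e) = lborel"
proof (rule measure_eqI)
  fix A :: "'a set" assume "A \<in> sets (distr lborel lborel (\<lambda>v. v + k v *\<^sub>R e))"
  then have A [measurable]: "A \<in> sets borel" by simp
  have "emeasure (distr lborel lborel (\<lambda>v. v + k v *\<^sub>R e)) A =
      (\<integral>\<^sup>+ v. indicator A v \<partial>distr lborel lborel (\<lambda>v. v + k v *\<^sub>R e))"
    by simp
  also have "\<dots> = (\<integral>\<^sup>+ v. indicator A (v + k v *\<^sub>R e) \<partial>lborel)"
    by (intro nn_integral_distr) measurable
  also have "\<dots> = (\<integral>\<^sup>+ v. indicator A (v + 0 *\<^sub>R e) \<partial>lborel)"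
    using nn_integral_shear_fibres[OF e k inv, of "indicator A"]
      nn_integral_shear_fibres[OF e, of "\<lambda>_. 0" "indicator A"] by simp
  also have "\<dots> = emeasure lborel A" by simp
  finally show "emeasure (distr lborel lborel (\<lambda>v. v + k v *\<^sub>R e)) A = emeasure lborel A" .
qed simp

section \<open>Volume-preserving splitting steps and their convergence to a flow\<close>

definition shear :: "('a::euclidean_space \<Rightarrow> 'a) \<Rightarrow> real \<Rightarrow> 'a \<Rightarrow> 'a \<Rightarrow> 'a" where
  "shear g h e v = v + (h * (g v \<bullet> e)) *\<^sub>R e"

text \<open>Lie splitting: Euler steps along the directions in \<open>es\<close>, last list element
  first, each evaluated at the point already reached. For a \<open>separable_field\<close> every
  factor preserves volume, whereas a simultaneous Euler step need not.\<close>

definition splitting_step :: "('a::euclidean_space \<Rightarrow> 'a) \<Rightarrow> 'a list \<Rightarrow> real \<Rightarrow> 'a \<Rightarrow> 'a" where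
  "splitting_step g es h = foldr (\<lambda>e \<psi>. shear g h e \<circ> \<psi>) es id"

definition lborel_preserving :: "('a::euclidean_space \<Rightarrow> 'a) \<Rightarrow> bool" where
  "lborel_preserving \<psi> \<longleftrightarrow> \<psi> \<in> borel_measurable borel \<and> distr lborel lborel \<psi> = lborel"

lemma lborel_preserving_id: "lborel_preserving id"
  by (simp add: lborel_preserving_def id_def distr_id)

lemma lborel_preserving_comp:
  assumes "lborel_preserving \<psi>" "lborel_preserving \<xi>"
  shows "lborel_preserving (\<psi> \<circ> \<xi>)"
proof -
  have "distr (distr lborel lborel \<xi>) lborel \<psi> = distr lborel lborel (\<psi> \<circ> \<xi>)"
    using assms by (intro distr_distr) (auto simp: lborel_preserving_def)
  then show ?thesis
    using assms measurable_comp[of \<xi> borel borel \<psi> borel] by (simp add: lborel_preserving_def)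
qed

lemma lborel_preserving_funpow:
  "lborel_preserving \<psi> \<Longrightarrow> lborel_preserving (\<psi> ^^ n)"
  by (induction n) (auto intro: lborel_preserving_id lborel_preserving_comp)

lemma emeasure_le_of_lborel_preserving:
  assumes "lborel_preserving \<psi>" "B \<in> sets borel" "\<And>v. v \<in> A \<Longrightarrow> \<psi> v \<in> B"
  shows "emeasure lborel A \<le> emeasure lborel B"
proof -
  have m: "\<psi> \<in> measurable lborel lborel" using assms(1) by (simp add: lborel_preserving_def)
  have "emeasure lborel A \<le> emeasure lborel (\<psi> -` B)"
    using assms(2,3) measurable_sets[OF m, of B] by (intro emeasure_mono) auto
  also have "\<dots> = emeasure (distr lborel lborel \<psi>) B"
    using m assms(2) by (simp add: emeasure_distr)
  finally show ?thesis using assms(1) by (simp add: lborel_preserving_def)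
qed

text \<open>By \<open>indep\<close> the component of the field along \<open>e\<close> does not vary
  along \<open>e\<close>, a strong form of vanishing divergence that turns Euler steps in one
  direction into measure-preserving shears. \<open>lip\<close> and \<open>bdd\<close> make the
  approximation uniform in the starting point.\<close>

locale separable_field =
  fixes g :: "'a::euclidean_space \<Rightarrow> 'a" and L M :: real
  assumes lip: "\<And>v w. norm (g v - g w) \<le> L * norm (v - w)"
    and bdd: "\<And>v. norm (g v) \<le> M"
    and indep: "\<And>v r e. e \<in> Basis \<Longrightarrow> g (v + r *\<^sub>R e) \<bullet> e = g v \<bullet> e"
    and L_pos: "0 < L"
begin

lemma M_nonneg: "0 \<le> M"
  using bdd[of 0] norm_ge_zero order_trans by blast

lemma continuous_field: "continuous_on UNIV g"
  by (rule lipschitz_on_continuous_on[of L])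
    (auto intro!: lipschitz_onI less_imp_le[OF L_pos] simp: dist_norm lip)

lemma lborel_preserving_shear:
  assumes "e \<in> Basis"
  shows "lborel_preserving (shear g h e)"
proof -
  have [measurable]: "g \<in> borel_measurable borel"
    by (rule borel_measurable_continuous_onI[OF continuous_field])
  show ?thesis
    using distr_shear_lborel[of e "\<lambda>v. h * (g v \<bullet> e)"] assms
    by (simp add: lborel_preserving_def shear_def[abs_def] indep)
qed

lemma lborel_preserving_splitting_step:
  "set es \<subseteq> Basis \<Longrightarrow> lborel_preserving (splitting_step g es h)"
  by (induction es)
    (auto simp: splitting_step_def intro: lborel_preserving_id
      intro!: lborel_preserving_comp lborel_preserving_shear)

lemma splitting_step_Cons:
  "splitting_step g (e # es) h v =
    splitting_step g es h v + (h * (g (splitting_step g es h v) \<bullet> e)) *\<^sub>R e"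
  by (simp add: splitting_step_def shear_def)

lemma splitting_step_drift:
  assumes "set es \<subseteq> Basis" "0 \<le> h"
  shows "norm (splitting_step g es h v - v) \<le> length es * (h * M)"
  using assms(1)
proof (induction es)
  case Nil
  then show ?case by (simp add: splitting_step_def)
next
  case (Cons e es)
  let ?w = "splitting_step g es h v"
  have "\<bar>g ?w \<bullet> e\<bar> \<le> M"
    using Basis_le_norm[of e "g ?w"] bdd[of ?w] Cons.prems by simp
  then have "norm ((h * (g ?w \<bullet> e)) *\<^sub>R e) \<le> h * M"
    using Cons.prems assms(2) by (simp add: abs_mult mult_left_mono)
  then have "norm ((?w - v) + (h * (g ?w \<bullet> e)) *\<^sub>R e) \<le> length es * (h * M) + h * M"
    using Cons by (intro norm_triangle_mono) auto
  then show ?case by (simp add: splitting_step_Cons algebra_simps)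
qed

text \<open>The shears are evaluated at displaced points, but by \<open>splitting_step_drift\<close>
  the displacements are of order \<open>h\<close>, so by \<open>lip\<close> the result differs from
  a simultaneous Euler step only by order \<open>h\<^sup>2\<close>.\<close>

lemma splitting_step_consistent:
  assumes "set es \<subseteq> Basis" "0 \<le> h"
  shows "norm (splitting_step g es h v - v - (\<Sum>e\<leftarrow>es. (h * (g v \<bullet> e)) *\<^sub>R e))
    \<le> (real (length es))\<^sup>2 * (L * M * h\<^sup>2)"
  using assms(1)
proof (induction es)
  case Nil
  then show ?case by (simp add: splitting_step_def)
next
  case (Cons e es)
  let ?w = "splitting_step g es h v" and ?n = "real (length es)"
  have "\<bar>(g ?w - g v) \<bullet> e\<bar> \<le> L * norm (?w - v)"
    using Basis_le_norm[of e "g ?w - g v"] lip[of ?w v] Cons.prems by simp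
  also have "\<dots> \<le> L * (?n * (h * M))"
    using splitting_step_drift[of es h v] Cons.prems assms(2) L_pos by (intro mult_left_mono) auto
  finally have "norm ((h * ((g ?w - g v) \<bullet> e)) *\<^sub>R e) \<le> h * (L * (?n * (h * M)))"
    using Cons.prems assms(2) by (simp add: abs_mult mult_left_mono)
  moreover have "splitting_step g (e # es) h v - v - (\<Sum>e\<leftarrow>e # es. (h * (g v \<bullet> e)) *\<^sub>R e) =
      (?w - v - (\<Sum>e\<leftarrow>es. (h * (g v \<bullet> e)) *\<^sub>R e)) + (h * ((g ?w - g v) \<bullet> e)) *\<^sub>R e"
    by (simp add: splitting_step_Cons inner_diff_left right_diff_distrib scaleR_diff_left)
  ultimately have "norm (splitting_step g (e # es) h v - v - (\<Sum>e\<leftarrow>e # es. (h * (g v \<bullet> e)) *\<^sub>R e))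
      \<le> ?n\<^sup>2 * (L * M * h\<^sup>2) + h * (L * (?n * (h * M)))"
    using Cons by (simp only:) (rule norm_triangle_mono, auto)
  also have "\<dots> = (?n\<^sup>2 + ?n) * (L * M * h\<^sup>2)"
    by (simp add: algebra_simps power2_eq_square)
  also have "\<dots> \<le> (real (length (e # es)))\<^sup>2 * (L * M * h\<^sup>2)"
    using L_pos M_nonneg by (intro mult_right_mono) (auto simp: power2_eq_square algebra_simps)
  finally show ?case .
qed

text \<open>The orbit has speed at most \<open>M\<close>, so over the interval the field differs
  from its initial value by at most \<open>L * M * h\<close>; this bounds the deviation from the
  tangent line.\<close>

lemma flow_consistent:
  assumes V: "\<And>t. (c has_vector_derivative g (c t)) (at t)" and "0 \<le> h"
  shows "norm (c (t + h) - c t - h *\<^sub>R g (c t)) \<le> L * M * h\<^sup>2"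
proof -
  have drift: "norm (c s - c t) \<le> M * h" if s: "s \<in> {t..t + h}" for s
  proof -
    have "norm (c s - c t) \<le> M * norm (s - t)"
    proof (rule differentiable_bound[of "{t..t + h}" c "\<lambda>s d. d *\<^sub>R g (c s)"])
      show "onorm (\<lambda>d. d *\<^sub>R g (c x)) \<le> M" for x
        using onorm_scaleR_left[of "\<lambda>d::real. d" "g (c x)"] bdd[of "c x"]
        by (simp add: bounded_linear_ident onorm_id[unfolded id_def])
    qed (use V s \<open>0 \<le> h\<close> in \<open>auto simp: has_vector_derivative_def intro: has_derivative_at_withinI\<close>)
    also have "\<dots> \<le> M * h" using s M_nonneg by (intro mult_left_mono) auto
    finally show ?thesis .
  qed
  have "norm (c (t + h) - c t - ((t + h) - t) *\<^sub>R g (c t)) \<le> norm ((t + h) - t) * (L * (M * h))"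
  proof (rule vector_differentiable_bound_linearization[where S = "{t..t + h}"])
    show "norm (g (c s) - g (c t)) \<le> L * (M * h)" if "s \<in> {t..t + h}" for s
      using lip[of "c s" "c t"] drift[OF that] L_pos by (meson mult_left_mono order_trans less_imp_le)
  qed (use V \<open>0 \<le> h\<close> in \<open>auto intro: has_vector_derivative_at_within simp: closed_segment_eq_real_ivl\<close>)
  then show ?thesis using \<open>0 \<le> h\<close> by (simp add: power2_eq_square algebra_simps)
qed

text \<open>Convergence of a one-step method: local errors of order \<open>h\<^sup>2\<close>
  accumulate over \<open>T / h\<close> steps, amplified by at most \<open>exp (L * T)\<close>, to a
  uniform error of order \<open>h\<close>. The third property keeps coordinates without drift fixed;
  \<open>lift_measure_le\<close> relies on it.\<close>

theorem flow_limit_of_lborel_preserving: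
  assumes V: "\<And>v t. (V v has_vector_derivative g (V v t)) (at t)" and V0: "\<And>v. V v 0 = v"
    and "0 < T" "0 < \<delta>"
  obtains \<psi> where "lborel_preserving \<psi>" "\<And>v. dist (\<psi> v) (V v T) < \<delta>"
    "\<And>v e. e \<in> Basis \<Longrightarrow> (\<And>w. g w \<bullet> e = 0) \<Longrightarrow> \<psi> v \<bullet> e = v \<bullet> e"
proof -
  obtain es :: "'a list" where es: "set es = Basis" "distinct es"
    using finite_distinct_list[OF finite_Basis] by blast
  define C where "C = ((real (length es))\<^sup>2 + 1) * (L * M)"
  have "0 \<le> C" using L_pos M_nonneg by (simp add: C_def)
  \<comment> \<open>Chosen so that the accumulated error \<open>C * T * exp (L * T) * T / N\<close>
    falls below \<delta>.\<close>
  obtain N :: nat where N: "C * T * exp (L * T) * T / \<delta> < N" "0 < N"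
    using reals_Archimedean2[of "max 0 (C * T * exp (L * T) * T / \<delta>)"] by (metis max_less_iff_conj of_nat_0_less_iff)
  define h where "h = T / N"
  have h: "0 < h" "N * h = T" using N \<open>0 < T\<close> by (simp_all add: h_def)
  define S where "S = splitting_step g es h"
  have basis_sum: "(\<Sum>e\<leftarrow>es. (h * (g v \<bullet> e)) *\<^sub>R e) = h *\<^sub>R g v" for v
    using es by (simp add: sum_list_distinct_conv_sum_set scaleR_sum_right[symmetric]
        scaleR_scaleR[symmetric] euclidean_representation del: scaleR_scaleR)
  \<comment> \<open>The two points may start apart: the Lipschitz bound amplifies their gap by
    \<open>1 + L * h\<close>, and each side adds its deviation from its own Euler step.
    \<open>C\<close> collects both deviations.\<close>
  have step_err: "norm (S v - V u (t + h)) \<le> (1 + L * h) * norm (v - V u t) + C * h\<^sup>2" for v u t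
  proof -
    let ?d = "v - V u t" and ?d' = "g v - g (V u t)"
      and ?x = "S v - v - h *\<^sub>R g v" and ?y = "V u (t + h) - V u t - h *\<^sub>R g (V u t)"
    have "S v - V u (t + h) = (?d + h *\<^sub>R ?d' + ?x) - ?y"
      by (simp add: algebra_simps)
    also have "norm \<dots> \<le> norm ?d + norm (h *\<^sub>R ?d') + norm ?x + norm ?y"
      by (meson add_mono norm_triangle_ineq norm_triangle_ineq4 order_refl order_trans)
    also have "\<dots> \<le> norm ?d + h * (L * norm ?d) + (real (length es))\<^sup>2 * (L * M * h\<^sup>2) + L * M * h\<^sup>2"
      using flow_consistent[of "V u" h t] splitting_step_consistent[of es h v] V h es(1) lip[of v "V u t"]
      by (intro add_mono) (auto simp: S_def basis_sum)
    finally show ?thesis by (simp add: C_def algebra_simps)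
  qed
  have err: "norm ((S ^^ k) v - V v (k * h)) \<le> k * (C * h\<^sup>2) * (1 + L * h) ^ k" for k v
  proof (induction k)
    case (Suc k)
    have q: "1 \<le> 1 + L * h" using L_pos h by simp
    have "norm ((S ^^ Suc k) v - V v (Suc k * h)) \<le>
        (1 + L * h) * norm ((S ^^ k) v - V v (k * h)) + C * h\<^sup>2"
      using step_err[of "(S ^^ k) v" v "k * h"] by (simp add: algebra_simps)
    also have "\<dots> \<le> (1 + L * h) * (k * (C * h\<^sup>2) * (1 + L * h) ^ k) + C * h\<^sup>2 * (1 + L * h) ^ Suc k"
    proof (intro add_mono mult_left_mono Suc.IH)
      have "C * h\<^sup>2 * 1 \<le> C * h\<^sup>2 * (1 + L * h) ^ Suc k"
        using q \<open>0 \<le> C\<close> one_le_power[OF q, of "Suc k"] by (intro mult_left_mono) auto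
      then show "C * h\<^sup>2 \<le> C * h\<^sup>2 * (1 + L * h) ^ Suc k" by simp
    qed (use q in auto)
    also have "\<dots> = Suc k * (C * h\<^sup>2) * (1 + L * h) ^ Suc k" by (simp add: algebra_simps)
    finally show ?case .
  qed (simp add: V0)
  have bound: "N * (C * h\<^sup>2) * (1 + L * h) ^ N < \<delta>"
  proof -
    have "(1 + L * h) ^ N \<le> exp (L * h) ^ N"
      using L_pos h by (intro power_mono) (auto simp: exp_ge_add_one_self add_nonneg_nonneg)
    also have "\<dots> = exp (L * T)" using h(2) by (simp add: exp_of_nat_mult[symmetric] algebra_simps)
    finally have "N * (C * h\<^sup>2) * (1 + L * h) ^ N \<le> N * (C * h\<^sup>2) * exp (L * T)"
      using \<open>0 \<le> C\<close> by (intro mult_left_mono) auto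
    also have "\<dots> = C * T * exp (L * T) * T / N"
      using N(2) by (simp add: h_def power2_eq_square)
    also have "\<dots> < \<delta>" using N \<open>0 < \<delta>\<close> by (simp add: field_simps)
    finally show ?thesis .
  qed
  show thesis
  proof (rule that[of "S ^^ N"])
    show "lborel_preserving (S ^^ N)"
      using es by (simp add: S_def lborel_preserving_funpow lborel_preserving_splitting_step)
    show "dist ((S ^^ N) v) (V v T) < \<delta>" for v
      using err[where k = N and v = v] bound h(2) by (simp add: dist_norm)
    fix v e assume e: "e \<in> Basis" and g0: "\<And>w. g w \<bullet> e = 0"
    \<comment> \<open>A shear along another basis vector leaves this coordinate alone, and the shear
      along \<open>e\<close> has length \<open>h * 0\<close>.\<close>
    have "splitting_step g ds h w \<bullet> e = w \<bullet> e" if "set ds \<subseteq> Basis" for ds w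
      using that
    proof (induction ds)
      case (Cons d ds)
      then show ?case
        using e g0[of "splitting_step g ds h w"]
        by (cases "d = e") (auto simp: splitting_step_Cons inner_simps inner_Basis)
    qed (simp add: splitting_step_def)
    then have "S w \<bullet> e = w \<bullet> e" for w using es by (simp add: S_def)
    then show "(S ^^ N) v \<bullet> e = v \<bullet> e" by (induction N) auto
  qed
qed

end

section \<open>Chains and the replicator flow\<close>

definition chain_step ::
    "'a::metric_space set \<Rightarrow> ('a \<Rightarrow> real \<Rightarrow> 'a) \<Rightarrow> real \<Rightarrow> real \<Rightarrow> 'a \<Rightarrow> 'a \<Rightarrow> bool" where
  "chain_step X \<phi> \<epsilon> T x y \<longleftrightarrow> x \<in> X \<and> y \<in> X \<and> (\<exists>t\<ge>T. dist (\<phi> x t) y < \<epsilon>)"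

text \<open>The requirement \<open>2 \<le> n\<close> means at least one jump, hence the transitive
  and not the reflexive closure. Concatenation of chains becomes transitivity.\<close>

lemma chain_iff_tranclp: "chain X \<phi> \<epsilon> T x y \<longleftrightarrow> (chain_step X \<phi> \<epsilon> T)\<^sup>+\<^sup>+ x y"
proof
  assume "chain X \<phi> \<epsilon> T x y"
  then obtain n :: nat and xs ts where c: "2 \<le> n" "xs 1 = x" "xs n = y" "\<forall>i\<in>{1..n}. xs i \<in> X"
      "\<forall>i\<in>{1..<n}. T \<le> ts i \<and> dist (\<phi> (xs i) (ts i)) (xs (Suc i)) < \<epsilon>"
    unfolding chain_def by blast
  have link: "chain_step X \<phi> \<epsilon> T (xs i) (xs (Suc i))" if "1 \<le> i" "i < n" for i
    using c(4,5) that by (auto simp: chain_step_def intro!: exI[of _ "ts i"])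
  have "(chain_step X \<phi> \<epsilon> T)\<^sup>+\<^sup>+ (xs 1) (xs (Suc k))" if "1 \<le> k" "k < n" for k
    using that
  proof (induction k rule: dec_induct)
    case base
    then show ?case using link[of 1] by auto
  next
    case (step k)
    then show ?case using link[of "Suc k"]
      by (simp add: tranclp.trancl_into_trancl)
  qed
  from this[of "n - 1"] show "(chain_step X \<phi> \<epsilon> T)\<^sup>+\<^sup>+ x y" using c(1-3) by simp
next
  assume "(chain_step X \<phi> \<epsilon> T)\<^sup>+\<^sup>+ x y"
  then show "chain X \<phi> \<epsilon> T x y"
  proof (induction rule: tranclp_induct)
    case (base y)
    then obtain t where "t \<ge> T" "dist (\<phi> x t) y < \<epsilon>" "x \<in> X" "y \<in> X"
      by (auto simp: chain_step_def)
    then show ?case unfolding chain_def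
      by (intro exI[of _ 2] exI[of _ "\<lambda>i. if i = 1 then x else y"] exI[of _ "\<lambda>_. t"]) auto
  next
    case (step y z)
    then obtain n :: nat and xs ts where c: "2 \<le> n" "xs 1 = x" "xs n = y" "\<forall>i\<in>{1..n}. xs i \<in> X"
      "\<forall>i\<in>{1..<n}. T \<le> ts i \<and> dist (\<phi> (xs i) (ts i)) (xs (Suc i)) < \<epsilon>"
      unfolding chain_def by blast
    obtain t where t: "t \<ge> T" "dist (\<phi> y t) z < \<epsilon>" "z \<in> X"
      using step.hyps by (auto simp: chain_step_def)
    show ?case unfolding chain_def
    proof (intro exI conjI)
      show "2 \<le> Suc n" "(xs(Suc n := z)) 1 = x" "(xs(Suc n := z)) (Suc n) = z" using c by auto
      show "\<forall>i\<in>{1..Suc n}. (xs(Suc n := z)) i \<in> X" using c t by auto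
      show "\<forall>i\<in>{1..<Suc n}. T \<le> (ts(n := t)) i \<and>
          dist (\<phi> ((xs(Suc n := z)) i) ((ts(n := t)) i)) ((xs(Suc n := z)) (Suc i)) < \<epsilon>"
        using c t by auto
    qed
  qed
qed

lemma chain_mono:
  assumes "chain X \<phi> \<epsilon> T x y" "\<epsilon> \<le> \<epsilon>'" "T' \<le> T"
  shows "chain X \<phi> \<epsilon>' T' x y"
proof -
  have step: "chain_step X \<phi> \<epsilon>' T' a b" if "chain_step X \<phi> \<epsilon> T a b" for a b
    using that assms(2,3) by (auto simp: chain_step_def) (meson less_le_trans order_trans)
  have "(chain_step X \<phi> \<epsilon> T)\<^sup>+\<^sup>+ x y" using assms(1) by (simp add: chain_iff_tranclp)
  then have "(chain_step X \<phi> \<epsilon>' T')\<^sup>+\<^sup>+ x y"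
    by (induction rule: tranclp_induct) (auto dest: step intro: tranclp.intros)
  then show ?thesis by (simp add: chain_iff_tranclp)
qed

lemma chain_trans: "chain X \<phi> \<epsilon> T x y \<Longrightarrow> chain X \<phi> \<epsilon> T y z \<Longrightarrow> chain X \<phi> \<epsilon> T x z"
  by (simp add: chain_iff_tranclp tranclp_trans)

lemma chain_single:
  "x \<in> X \<Longrightarrow> y \<in> X \<Longrightarrow> T \<le> t \<Longrightarrow> dist (\<phi> x t) y < \<epsilon> \<Longrightarrow> chain X \<phi> \<epsilon> T x y"
  by (auto simp: chain_iff_tranclp chain_step_def intro!: tranclp.r_into_trancl)

lemma chain_in:
  assumes "chain X \<phi> \<epsilon> T x y" shows "x \<in> X" "y \<in> X"
  using assms unfolding chain_def by (metis atLeastAtMost_iff order_refl le_trans one_le_numeral)+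

text \<open>Integrating factor: with \<open>A\<close> an antiderivative of \<open>a\<close>, the
  product \<open>y t * exp (- A t)\<close> is constant.\<close>

lemma exp_growth_of_linear_ode:
  fixes y a :: "real \<Rightarrow> real"
  assumes y: "\<And>t. (y has_real_derivative y t * a t) (at t)" and a: "continuous_on UNIV a"
  obtains A where "\<And>t. y t = y 0 * exp (A t)"
proof -
  obtain A where A: "\<And>t. (A has_real_derivative a t) (at t)"
    using einterval_antiderivative[of "-\<infinity>" "\<infinity>" a] a
    by (auto simp: continuous_on_eq_continuous_at has_real_derivative_iff_has_vector_derivative)
  have "((\<lambda>t. y t * exp (- A t)) has_real_derivative 0) (at t)" for t
    using y[of t] A[of t] by (auto intro!: derivative_eq_intros)
  then have const: "y t * exp (- A t) = y 0 * exp (- A 0)" for t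
    using DERIV_isconst_all[of "\<lambda>t. y t * exp (- A t)"] by blast
  have "y t = y 0 * exp (A t - A 0)" for t
  proof -
    have "y t = y t * exp (- A t) * exp (A t)" by (simp add: exp_minus)
    also have "\<dots> = y 0 * exp (- A 0) * exp (A t)" using const[of t] by metis
    also have "\<dots> = y 0 * exp (A t - A 0)" by (simp add: exp_minus exp_diff divide_inverse)
    finally show ?thesis .
  qed
  then show thesis by (rule that)
qed

section \<open>Coordinates along replicator orbits\<close>

locale replicator =
  fixes G :: "('i::finite, 's::finite) game" and \<phi> :: "real^'s^'i \<Rightarrow> real \<Rightarrow> real^'s^'i"
  assumes fin: "finite_game G" and flow: "replicator_flow G \<phi>"
begin

abbreviation "X \<equiv> strategy_space G"
abbreviation "I \<equiv> players G"
abbreviation "S \<equiv> strategies G"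
abbreviation "D \<equiv> deviation_utility G"

text \<open>The per-capita rate: coordinate \<open>(i, s)\<close> of the replicator field is
  \<open>x $ i $ s * growth i s x\<close>.\<close>

definition growth :: "'i \<Rightarrow> 's \<Rightarrow> real^'s^'i \<Rightarrow> real" where
  "growth i s x = D i s x - (\<Sum>t\<in>S i. x $ i $ t * D i t x)"

lemma flow_in: "x \<in> X \<Longrightarrow> \<phi> x t \<in> X"
  and flow_0: "x \<in> X \<Longrightarrow> \<phi> x 0 = x"
  using flow by (auto simp: replicator_flow_def)

lemma X_D:
  assumes "x \<in> X"
  shows "0 \<le> x $ i $ s" "x $ i $ s \<le> 1" "i \<in> I \<Longrightarrow> (\<Sum>s\<in>S i. x $ i $ s) = 1"
    "i \<notin> I \<or> s \<notin> S i \<Longrightarrow> x $ i $ s = 0"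
proof -
  show nn: "0 \<le> x $ i $ s" for s using assms by (cases "i \<in> I \<and> s \<in> S i") (auto simp: strategy_space_def)
  show sum: "i \<in> I \<Longrightarrow> (\<Sum>s\<in>S i. x $ i $ s) = 1" and z: "i \<notin> I \<or> s \<notin> S i \<Longrightarrow> x $ i $ s = 0"
    using assms by (auto simp: strategy_space_def)
  show "x $ i $ s \<le> 1"
  proof (cases "i \<in> I \<and> s \<in> S i")
    case True
    then show ?thesis using member_le_sum[of s "S i" "\<lambda>s. x $ i $ s"] sum nn by auto
  qed (use z in auto)
qed

lemma continuous_D: "continuous_on A (D i s)"
proof -
  have "continuous_on A (\<lambda>x. ((if j = i then axis s 1 else x $ j)::real^'s) $ r)" for j r
    by (cases "j = i") (auto intro!: continuous_intros)
  then show ?thesis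
    unfolding deviation_utility_def[abs_def] expected_utility_def vec_lambda_beta
    by (intro continuous_on_sum continuous_on_mult continuous_on_prod continuous_on_const)
qed

lemma continuous_growth: "continuous_on A (growth i s)"
  unfolding growth_def[abs_def] by (intro continuous_intros continuous_D)

lemma coord_deriv:
  assumes "x \<in> X"
  shows "((\<lambda>t. \<phi> x t $ i $ s) has_real_derivative \<phi> x t $ i $ s * growth i s (\<phi> x t)) (at t)"
proof -
  have "(\<phi> x has_vector_derivative replicator_field G (\<phi> x t)) (at t)"
    using flow assms by (auto simp: replicator_flow_def)
  moreover have "bounded_linear (\<lambda>x::real^'s^'i. x $ i $ s)"
    by (rule bounded_linear_compose[OF bounded_linear_vec_nth bounded_linear_vec_nth])
  ultimately have "((\<lambda>t. \<phi> x t $ i $ s) has_vector_derivative replicator_field G (\<phi> x t) $ i $ s) (at t)"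
    using bounded_linear.has_vector_derivative by blast
  then show ?thesis
    by (simp add: has_real_derivative_iff_has_vector_derivative replicator_field_def growth_def)
qed

lemma continuous_flow: "x \<in> X \<Longrightarrow> continuous_on A (\<phi> x)"
  using flow unfolding replicator_flow_def
  by (metis continuous_at_imp_continuous_on has_vector_derivative_continuous)

text \<open>Each coordinate solves a scalar linear equation along the orbit. Hence the support of a
  mixed profile is invariant, and with it every face and its relative interior.\<close>

lemma coord_exp:
  assumes "x \<in> X"
  obtains A where "\<And>t. \<phi> x t $ i $ s = x $ i $ s * exp (A t)"
proof -
  have "continuous_on UNIV (\<lambda>t. growth i s (\<phi> x t))"
    by (rule continuous_on_compose2[OF continuous_growth continuous_flow[OF assms]]) auto
  from exp_growth_of_linear_ode[OF coord_deriv[OF assms] this] show thesis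
    using that flow_0[OF assms] by metis
qed

lemma coord_zero: "x \<in> X \<Longrightarrow> x $ i $ s = 0 \<Longrightarrow> \<phi> x t $ i $ s = 0"
  using coord_exp[of x i s] by (metis mult_zero_left)

lemma coord_pos_iff: "x \<in> X \<Longrightarrow> 0 < \<phi> x t $ i $ s \<longleftrightarrow> 0 < x $ i $ s"
  by (rule coord_exp[of x i s]) (auto simp: zero_less_mult_iff)

text \<open>The average payoff occurs in both logarithmic growth rates and cancels, leaving a payoff
  difference.\<close>

lemma log_ratio_deriv:
  assumes "x \<in> X" "0 < x $ i $ s" "0 < x $ i $ r"
  shows "((\<lambda>t. ln (\<phi> x t $ i $ s) - ln (\<phi> x t $ i $ r)) has_real_derivative
    D i s (\<phi> x t) - D i r (\<phi> x t)) (at t)"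
proof -
  have "0 < \<phi> x t $ i $ s" "0 < \<phi> x t $ i $ r" using assms by (auto simp: coord_pos_iff)
  then show ?thesis
    by (auto intro!: derivative_eq_intros coord_deriv[OF assms(1)] simp: growth_def)
qed

text \<open>Every other profile gets weight zero from some player. The mixture \<open>x $ i\<close>
  is arbitrary, as the deviation overwrites it, so the formula holds along whole edges.\<close>

lemma D_pure:
  assumes "p \<in> profiles G" "i \<in> I" "s \<in> S i" "\<And>j. j \<in> I - {i} \<Longrightarrow> x $ j = axis (p j) 1"
  shows "D i s x = utility G (p(i := s)) i"
proof -
  have p': "p(i := s) \<in> profiles G" using assms(1-3) by (auto simp: profiles_def PiE_def Pi_def extensional_def)
  have "(\<Prod>j\<in>I. ((if j = i then axis s 1 else x $ j)::real^'s) $ q j) = (if q = p(i := s) then 1 else 0)"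
    if q: "q \<in> profiles G" for q
  proof (cases "q = p(i := s)")
    case True
    then show ?thesis using assms(2,4) by (auto simp: axis_def intro!: prod.neutral)
  next
    case False
    then obtain j where j: "j \<in> I" "q j \<noteq> (p(i := s)) j"
      using q p' unfolding profiles_def by (meson PiE_ext)
    then have "\<exists>j\<in>I. ((if j = i then axis s 1 else x $ j)::real^'s) $ q j = 0"
      using assms(4)[of j] by (cases "j = i") (auto simp: axis_def intro!: bexI[of _ j])
    then show ?thesis using False by (simp add: prod_zero)
  qed
  then have "D i s x = (\<Sum>q\<in>profiles G. utility G q i * (if q = p(i := s) then 1 else 0))"
    by (simp add: deviation_utility_def expected_utility_def)
  also have "\<dots> = (\<Sum>q\<in>profiles G. if q = p(i := s) then utility G q i else 0)"
    by (intro sum.cong) auto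
  also have "\<dots> = utility G (p(i := s)) i"
    using p' fin by (subst sum.delta) (auto simp: profiles_def finite_game_def intro!: finite_PiE)
  finally show ?thesis .
qed

lemma pure_point_nth: "i \<in> I \<Longrightarrow> pure_point G p $ i = axis (p i) 1"
  by (simp add: pure_point_def vec_eq_iff axis_def)

lemma pure_point_in: "p \<in> profiles G \<Longrightarrow> pure_point G p \<in> X"
  by (auto simp: strategy_space_def pure_point_def profiles_def PiE_def Pi_def)

lemma eq_pure_pointI:
  assumes "x \<in> X" "p \<in> profiles G" "\<And>i. i \<in> I \<Longrightarrow> 1 \<le> x $ i $ p i"
  shows "x = pure_point G p"
proof -
  have "x $ i $ s = pure_point G p $ i $ s" for i s
  proof (cases "i \<in> I")
    case True
    have pi: "p i \<in> S i" using assms(2) True by (auto simp: profiles_def)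
    have one: "x $ i $ p i = 1" using assms(3)[OF True] X_D(2)[OF assms(1), of i "p i"] by simp
    have "(\<Sum>s\<in>S i - {p i}. x $ i $ s) = 0"
      using X_D(3)[OF assms(1) True] one by (simp add: sum_diff1 pi)
    then have "x $ i $ s = 0" if "s \<in> S i - {p i}" for s
      using that X_D(1)[OF assms(1)] by (subst (asm) sum_nonneg_eq_0_iff) auto
    then show ?thesis using True one X_D(4)[OF assms(1), of i s]
      by (cases "s = p i"; cases "s \<in> S i") (auto simp: pure_point_def)
  qed (use X_D(4)[OF assms(1)] in \<open>auto simp: pure_point_def\<close>)
  then show ?thesis by (simp add: vec_eq_iff)
qed

lemma flow_pure_point:
  assumes "p \<in> profiles G"
  shows "\<phi> (pure_point G p) t = pure_point G p"
proof (rule eq_pure_pointI[OF flow_in[OF pure_point_in[OF assms]] assms])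
  let ?x = "pure_point G p"
  fix i assume i: "i \<in> I"
  have pi: "p i \<in> S i" using assms i by (auto simp: profiles_def)
  have "\<phi> ?x t $ i $ s = 0" if "s \<noteq> p i" for s
    using that by (intro coord_zero pure_point_in assms) (auto simp: pure_point_def)
  then have "(\<Sum>s\<in>S i. \<phi> ?x t $ i $ s) = \<phi> ?x t $ i $ p i"
    using pi by (subst sum.remove[of _ "p i"]) auto
  then show "1 \<le> \<phi> ?x t $ i $ p i" using X_D(3)[OF flow_in[OF pure_point_in[OF assms]] i] by simp
qed

lemma chain_pure_point_refl:
  assumes "p \<in> profiles G" "0 < \<epsilon>"
  shows "chain X \<phi> \<epsilon> T (pure_point G p) (pure_point G p)"
  using assms by (intro chain_single[of _ _ _ _ T]) (auto simp: flow_pure_point pure_point_in)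

end

lemma norm_le_sum_coords: "norm (x::real^'s^'i) \<le> (\<Sum>i\<in>UNIV. \<Sum>s\<in>UNIV. \<bar>x $ i $ s\<bar>)"
proof -
  have "norm x \<le> (\<Sum>i\<in>UNIV. norm (x $ i))" by (simp add: norm_vec_def L2_set_le_sum)
  also have "\<dots> \<le> (\<Sum>i\<in>UNIV. \<Sum>s\<in>UNIV. \<bar>x $ i $ s\<bar>)" by (intro sum_mono norm_le_l1_cart)
  finally show ?thesis .
qed

lemma norm_le_coord_bound:
  assumes "\<And>i s. \<bar>(x::real^'s^'i) $ i $ s\<bar> \<le> d"
  shows "norm x \<le> real (CARD('i) * CARD('s)) * d"
proof -
  have "norm x \<le> (\<Sum>i\<in>(UNIV::'i set). \<Sum>s\<in>(UNIV::'s set). d)"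
    by (rule order_trans[OF norm_le_sum_coords]) (intro sum_mono assms)
  then show ?thesis by simp
qed

lemma abs_coord_le_norm: "\<bar>x $ i $ s\<bar> \<le> norm (x::real^'s^'i)"
  using component_le_norm_cart[of "x $ i" s] Finite_Cartesian_Product.norm_nth_le[of x i] by linarith

lemma Basis_vec2: "(Basis :: (real^'s^'i) set) = {axis i (axis s 1) | i s. True}"
  by (auto simp: Basis_vec_def Basis_real_def)

lemma inner_axis_axis2: "(v::real^'s^'i) \<bullet> axis i (axis s 1) = v $ i $ s"
  by (simp add: inner_axis)

lemma convex_strategy_space: "convex (strategy_space G)"
  unfolding convex_def strategy_space_def
  by (auto simp: sum.distrib sum_distrib_left[symmetric])

lemma chain_last_step:
  assumes "chain X \<phi> \<epsilon> T x y"
  obtains w t where "w = x \<or> chain X \<phi> \<epsilon> T x w" "w \<in> X" "T \<le> t" "dist (\<phi> w t) y < \<epsilon>"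
  using assms unfolding chain_iff_tranclp by (cases rule: tranclp.cases) (auto simp: chain_step_def)

lemma chain_append:
  assumes "w = x \<or> chain X \<phi> \<epsilon> T x w" "w \<in> X" "y \<in> X" "T \<le> t" "dist (\<phi> w t) y < \<epsilon>"
  shows "chain X \<phi> \<epsilon> T x y"
  using assms chain_single[of w X y T t \<phi> \<epsilon>] chain_trans[of X \<phi> \<epsilon> T x w y] by auto

text \<open>Only the target of the last jump moves, so enlarging the tolerance by \<epsilon>'
  suffices.\<close>

lemma chain_perturb_end:
  assumes "chain X \<phi> \<epsilon> T x y" "z \<in> X" "dist y z < \<epsilon>'" "0 \<le> \<epsilon>'"
  shows "chain X \<phi> (\<epsilon> + \<epsilon>') T x z"
proof -
  obtain w t where w: "w = x \<or> chain X \<phi> \<epsilon> T x w" "w \<in> X" "T \<le> t" "dist (\<phi> w t) y < \<epsilon>"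
    by (rule chain_last_step[OF assms(1)])
  have "dist (\<phi> w t) z < \<epsilon> + \<epsilon>'"
    using w(4) assms(3) dist_triangle[of "\<phi> w t" z y] by linarith
  moreover have "w = x \<or> chain X \<phi> (\<epsilon> + \<epsilon>') T x w"
    using w(1) assms(4) chain_mono[of X \<phi> \<epsilon> T x w "\<epsilon> + \<epsilon>'" T] by auto
  ultimately show ?thesis using w assms(2) by (intro chain_append[of w x X \<phi> _ T z t]) auto
qed

section \<open>Reaching the boundary of a face\<close>

text \<open>The sets \<open>T i\<close> span a face of the strategy space. The \<open>b i\<close>
  are reference strategies: logarithms of ratios to their probabilities serve as coordinates in the
  relative interior.\<close>

locale replicator_face = replicator G \<phi>
  for G :: "('i::finite, 's::finite) game" and \<phi> +
  fixes T :: "'i \<Rightarrow> 's set" and b :: "'i \<Rightarrow> 's"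
  assumes T_sub: "\<And>i. i \<in> I \<Longrightarrow> T i \<subseteq> S i" and b_in: "\<And>i. i \<in> I \<Longrightarrow> b i \<in> T i"
begin

definition face :: "(real^'s^'i) set" where
  "face = {x \<in> X. \<forall>i\<in>I. \<forall>s\<in>S i - T i. x $ i $ s = 0}"

definition face_interior :: "(real^'s^'i) set" where
  "face_interior = {x \<in> face. \<forall>i\<in>I. \<forall>s\<in>T i. 0 < x $ i $ s}"

text \<open>The inverse of the logarithmic coordinates. It parametrises the relative interior by a
  full vector space, which carries Lebesgue measure, at the price of redundancy: adding a constant
  to all entries of one player changes nothing.\<close>

definition softmax :: "real^'s^'i \<Rightarrow> real^'s^'i" where
  "softmax v = (\<chi> i s. if i \<in> I \<and> s \<in> T i then exp (v $ i $ s) / (\<Sum>t\<in>T i. exp (v $ i $ t)) else 0)"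

text \<open>The replicator field in the coordinates of \<open>log_ratio_deriv\<close>. It vanishes
  at the references \<open>b i\<close> and at the coordinates that \<open>softmax\<close>
  ignores.\<close>

definition log_field :: "real^'s^'i \<Rightarrow> real^'s^'i" where
  "log_field v = (\<chi> i s. if i \<in> I \<and> s \<in> T i
     then D i s (softmax v) - D i (b i) (softmax v) else 0)"

text \<open>The lift of a replicator orbit through \<open>softmax\<close>; the summand
  \<open>v $ i $ b i\<close> makes it start at \<open>v\<close>.\<close>

definition log_orbit :: "real^'s^'i \<Rightarrow> real \<Rightarrow> real^'s^'i" where
  "log_orbit v t = (\<chi> i s. if i \<in> I \<and> s \<in> T i
     then ln (\<phi> (softmax v) t $ i $ s) - ln (\<phi> (softmax v) t $ i $ b i) + v $ i $ b i else v $ i $ s)"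

lemma face_sum: "x \<in> face \<Longrightarrow> i \<in> I \<Longrightarrow> (\<Sum>s\<in>T i. x $ i $ s) = 1"
  using X_D(3)[of x i] T_sub[of i] sum.mono_neutral_right[of "S i" "T i" "\<lambda>s. x $ i $ s"]
  by (auto simp: face_def)

lemma faceI:
  assumes "\<And>i s. i \<in> I \<Longrightarrow> s \<in> T i \<Longrightarrow> 0 \<le> x $ i $ s" "\<And>i. i \<in> I \<Longrightarrow> (\<Sum>s\<in>T i. x $ i $ s) = 1"
    "\<And>i s. i \<notin> I \<or> s \<notin> T i \<Longrightarrow> x $ i $ s = 0"
  shows "x \<in> face"
proof -
  have "(\<Sum>s\<in>S i. x $ i $ s) = 1" if "i \<in> I" for i
    using assms(2)[OF that] sum.mono_neutral_right[of "S i" "T i" "\<lambda>s. x $ i $ s"] T_sub[OF that] assms(3)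
    by auto
  moreover have "0 \<le> x $ i $ s" for i s
    using assms(1,3)[of i s] by (cases "i \<in> I \<and> s \<in> T i") auto
  moreover have "x $ i $ s = 0" if "i \<notin> I \<or> s \<notin> S i" for i s
    using assms(3)[of i s] T_sub[of i] that by blast
  ultimately show ?thesis using assms(3) by (auto simp: face_def strategy_space_def)
qed

lemma face_D:
  assumes "x \<in> face"
  shows "x \<in> X" "0 \<le> x $ i $ s" "x $ i $ s \<le> 1" "i \<notin> I \<or> s \<notin> T i \<Longrightarrow> x $ i $ s = 0"
  using assms X_D(1,2,4)[of x i s] by (auto simp: face_def)

lemma sum_exp_pos: "i \<in> I \<Longrightarrow> 0 < (\<Sum>t\<in>T i. exp (v $ i $ t :: real))"
  using b_in[of i] by (intro sum_pos) auto

lemma softmax_in: "softmax v \<in> face_interior"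
proof -
  have "0 < softmax v $ i $ s" if "i \<in> I" "s \<in> T i" for i s
    using sum_exp_pos[OF that(1), of v] that by (simp add: softmax_def)
  moreover have "(\<Sum>s\<in>T i. softmax v $ i $ s) = 1" if "i \<in> I" for i
    using sum_exp_pos[OF that, of v] that by (simp add: softmax_def sum_divide_distrib[symmetric])
  ultimately show ?thesis
    by (auto simp: face_interior_def softmax_def intro!: faceI less_imp_le)
qed

lemma softmax_face: "softmax v \<in> face" and softmax_X: "softmax v \<in> X"
  using softmax_in[of v] by (auto simp: face_interior_def face_def)

text \<open>If entries change by at most \<open>d\<close>, the numerator keeps at least the fraction
  \<open>exp (- d)\<close> and the denominator grows at most by \<open>exp d\<close>. Then
  \<open>1 - 2 * d \<le> exp (- (2 * d))\<close>, with values at most 1, gives an additive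
  bound.\<close>

lemma softmax_lower: "softmax w $ i $ s - 2 * norm (v - w) \<le> softmax v $ i $ s"
proof (cases "i \<in> I \<and> s \<in> T i")
  case True
  define d where "d = norm (v - w)"
  have vw: "w $ i $ t - d \<le> v $ i $ t" "v $ i $ t \<le> w $ i $ t + d" for t
    using abs_coord_le_norm[of "v - w" i t] by (auto simp: d_def)
  have "(\<Sum>t\<in>T i. exp (v $ i $ t)) \<le> (\<Sum>t\<in>T i. exp (w $ i $ t + d))"
    using vw(2) by (intro sum_mono) auto
  also have "\<dots> = exp d * (\<Sum>t\<in>T i. exp (w $ i $ t))"
    by (simp add: exp_add sum_distrib_left mult.commute)
  finally have den: "(\<Sum>t\<in>T i. exp (v $ i $ t)) \<le> exp d * (\<Sum>t\<in>T i. exp (w $ i $ t))" .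
  have "(1 - 2 * d) * softmax w $ i $ s \<le> exp (- (2 * d)) * softmax w $ i $ s"
    using exp_ge_add_one_self[of "- (2 * d)"] face_D(2)[OF softmax_face]
    by (intro mult_right_mono) auto
  also have "\<dots> = exp (w $ i $ s - d) / (exp d * (\<Sum>t\<in>T i. exp (w $ i $ t)))"
    using True by (simp add: softmax_def exp_diff exp_minus field_simps mult_exp_exp flip: mult_2)
  also have "\<dots> \<le> exp (v $ i $ s) / (\<Sum>t\<in>T i. exp (v $ i $ t))"
    using den vw(1)[of s] sum_exp_pos[of i v] True by (intro frac_le) auto
  also have "\<dots> = softmax v $ i $ s" using True by (simp add: softmax_def)
  finally have "softmax w $ i $ s - 2 * d * softmax w $ i $ s \<le> softmax v $ i $ s"
    by (simp add: algebra_simps)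
  moreover have "2 * d * softmax w $ i $ s \<le> 2 * d * 1"
    using face_D(3)[OF softmax_face] by (intro mult_left_mono) (auto simp: d_def)
  ultimately show ?thesis by (simp add: d_def)
qed (auto simp: softmax_def)

lemma softmax_coord_lipschitz: "\<bar>softmax v $ i $ s - softmax w $ i $ s\<bar> \<le> 2 * norm (v - w)"
  using softmax_lower[of w i s v] softmax_lower[of v i s w] by (simp add: norm_minus_commute abs_le_iff)

definition "coords = real (CARD('i) * CARD('s))"

lemma coords_pos: "0 < coords" by (simp add: coords_def)

lemmas norm_le_coords = norm_le_coord_bound[where 'i = 'i and 's = 's, folded coords_def]

lemma softmax_lipschitz: "dist (softmax v) (softmax w) \<le> coords * 2 * dist v w"
  using norm_le_coords[of "softmax v - softmax w" "2 * norm (v - w)"] softmax_coord_lipschitz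
  by (simp add: dist_norm)

lemma continuous_softmax: "continuous_on UNIV softmax"
  by (rule lipschitz_on_continuous_on[of "coords * 2"])
    (use softmax_lipschitz coords_pos in \<open>auto intro!: lipschitz_onI\<close>)

section \<open>Uniform bounds for payoffs and for the logarithmic field\<close>

definition util_bound :: real where
  "util_bound = (\<Sum>i\<in>I. \<Sum>q\<in>profiles G. \<bar>utility G q i\<bar>)"

lemma util_bound: "i \<in> I \<Longrightarrow> (\<Sum>q\<in>profiles G. \<bar>utility G q i\<bar>) \<le> util_bound"
  unfolding util_bound_def by (rule member_le_sum) (auto intro: sum_nonneg)

lemma util_bound_nonneg: "0 \<le> util_bound"
  by (auto simp: util_bound_def intro!: sum_nonneg)

text \<open>All factors lie in the unit interval, so a product of them changes by at most the sum of
  the changes of its factors.\<close>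

lemma D_lipschitz:
  fixes d :: real
  assumes "x \<in> X" "y \<in> X" "i \<in> I" "\<And>j r. \<bar>x $ j $ r - y $ j $ r\<bar> \<le> d"
  shows "\<bar>D i s x - D i s y\<bar> \<le> util_bound * (CARD('i) * d)"
proof -
  let ?c = "\<lambda>x j. (if j = i then axis s 1 else x $ j)::real^'s"
  have d: "0 \<le> d" using assms(4) abs_ge_zero order_trans by blast
  have prods: "\<bar>(\<Prod>j\<in>I. ?c x j $ q j) - (\<Prod>j\<in>I. ?c y j $ q j)\<bar> \<le> CARD('i) * d" for q
  proof -
    have "norm ((\<Prod>j\<in>I. ?c x j $ q j) - (\<Prod>j\<in>I. ?c y j $ q j))
        \<le> (\<Sum>j\<in>I. norm (?c x j $ q j - ?c y j $ q j))"
      using X_D[OF assms(1)] X_D[OF assms(2)] by (intro norm_prod_diff) (auto simp: axis_def)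
    also have "\<dots> \<le> (\<Sum>j\<in>I. d)" using assms(4) d by (intro sum_mono) auto
    also have "\<dots> \<le> CARD('i) * d" using d by (simp add: mult_right_mono card_mono)
    finally show ?thesis by simp
  qed
  have "\<bar>D i s x - D i s y\<bar> = \<bar>\<Sum>q\<in>profiles G. utility G q i *
      ((\<Prod>j\<in>I. ?c x j $ q j) - (\<Prod>j\<in>I. ?c y j $ q j))\<bar>"
    by (simp add: deviation_utility_def expected_utility_def right_diff_distrib sum_subtractf)
  also have "\<dots> \<le> (\<Sum>q\<in>profiles G. \<bar>utility G q i\<bar> * (CARD('i) * d))"
    by (rule order_trans[OF sum_abs]) (auto simp: abs_mult intro!: sum_mono mult_left_mono prods)
  also have "\<dots> \<le> util_bound * (CARD('i) * d)"
    using util_bound[OF assms(3)] d by (auto simp flip: sum_distrib_right intro: mult_right_mono)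
  finally show ?thesis .
qed

lemma D_bound:
  assumes "x \<in> X" "i \<in> I"
  shows "\<bar>D i s x\<bar> \<le> util_bound"
proof -
  let ?c = "\<lambda>j. (if j = i then axis s 1 else x $ j)::real^'s"
  have "\<bar>\<Prod>j\<in>I. ?c j $ q j\<bar> \<le> 1" for q
    using X_D[OF assms(1)] by (auto simp: abs_prod axis_def intro!: prod_le_1)
  then have "\<bar>D i s x\<bar> \<le> (\<Sum>q\<in>profiles G. \<bar>utility G q i\<bar>)"
    unfolding deviation_utility_def expected_utility_def vec_lambda_beta
    by (intro order_trans[OF sum_abs] sum_mono) (simp add: abs_mult mult_left_le)
  then show ?thesis using util_bound[OF assms(2)] by linarith
qed

text \<open>A deviation utility ignores the deviating player's own mixture. This is the source of
  the property \<open>indep\<close> for \<open>log_field\<close>.\<close>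

lemma D_cong:
  assumes "\<And>j. j \<in> I \<Longrightarrow> j \<noteq> i \<Longrightarrow> x $ j = y $ j" shows "D i s x = D i s y"
  unfolding deviation_utility_def expected_utility_def vec_lambda_beta
  by (intro sum.cong refl arg_cong2[where f = "(*)"] prod.cong) (auto simp: assms)

text \<open>In the Lipschitz constant the inner 2 comes from \<open>softmax_coord_lipschitz\<close>,
  the outer 2 from the difference of two payoffs, and \<open>coords\<close> from passing to the
  norm. The summand 1 keeps it positive when all utilities vanish.\<close>

sublocale log: separable_field log_field
  "coords * (2 * (util_bound * (CARD('i) * 2))) + 1" "coords * (2 * util_bound)"
proof
  fix v w :: "real^'s^'i"
  have "\<bar>(log_field v - log_field w) $ i $ s\<bar> \<le> 2 * (util_bound * (CARD('i) * (2 * norm (v - w))))" for i s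
  proof (cases "i \<in> I \<and> s \<in> T i")
    case True
    have "\<bar>D i r (softmax v) - D i r (softmax w)\<bar> \<le> util_bound * (CARD('i) * (2 * norm (v - w)))" for r
      using True by (intro D_lipschitz softmax_X softmax_coord_lipschitz) auto
    from this[of s] this[of "b i"] show ?thesis using True by (auto simp: log_field_def)
  qed (auto simp: log_field_def util_bound_nonneg)
  then have "norm (log_field v - log_field w) \<le> coords * (2 * (util_bound * (CARD('i) * (2 * norm (v - w)))))"
    by (rule norm_le_coords)
  also have "\<dots> \<le> (coords * (2 * (util_bound * (CARD('i) * 2))) + 1) * norm (v - w)"
    by (simp add: algebra_simps)
  finally show "norm (log_field v - log_field w) \<le> \<dots>" .
  have "\<bar>log_field v $ i $ s\<bar> \<le> 2 * util_bound" for i s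
    using D_bound[OF softmax_X, of i s v] D_bound[OF softmax_X, of i "b i" v] util_bound_nonneg
    by (auto simp: log_field_def)
  then show "norm (log_field v) \<le> coords * (2 * util_bound)" by (rule norm_le_coords)
  show "0 < coords * (2 * (util_bound * (CARD('i) * 2))) + 1"
    using coords_pos util_bound_nonneg by (auto intro!: add_nonneg_pos mult_nonneg_nonneg)
next
  fix v e :: "real^'s^'i" and r :: real assume "e \<in> Basis"
  then obtain i s where e: "e = axis i (axis s 1)" by (auto simp: Basis_vec2)
  have "softmax (v + r *\<^sub>R e) $ j = softmax v $ j" if "j \<noteq> i" for j
    using that by (auto simp: softmax_def e axis_def vec_eq_iff)
  then have "D i u (softmax (v + r *\<^sub>R e)) = D i u (softmax v)" for u by (intro D_cong) auto
  then show "log_field (v + r *\<^sub>R e) \<bullet> e = log_field v \<bullet> e"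
    by (simp add: e inner_axis_axis2 log_field_def)
qed

section \<open>Replicator orbits in logarithmic coordinates\<close>

lemma flow_face_interior:
  assumes "x \<in> face_interior" shows "\<phi> x t \<in> face_interior"
proof -
  have x: "x \<in> X" using assms by (auto simp: face_interior_def face_def)
  then show ?thesis using assms coord_zero[OF x] coord_pos_iff[OF x] flow_in[OF x] by (auto simp: face_interior_def face_def)
qed

lemma log_orbit_0: "log_orbit v 0 = v"
proof -
  have "ln (softmax v $ i $ s) - ln (softmax v $ i $ b i) = v $ i $ s - v $ i $ b i" if "i \<in> I" "s \<in> T i" for i s
    using that b_in[of i] sum_exp_pos[of i v] by (simp add: softmax_def ln_div)
  then show ?thesis by (simp add: log_orbit_def flow_0 softmax_X vec_eq_iff)
qed

lemma softmax_log_orbit: "softmax (log_orbit v t) = \<phi> (softmax v) t"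
proof -
  let ?x = "\<phi> (softmax v) t"
  have x: "?x \<in> face_interior" by (intro flow_face_interior softmax_in)
  then have xf: "?x \<in> face" by (simp add: face_interior_def)
  have "softmax (log_orbit v t) $ i $ s = ?x $ i $ s" for i s
  proof (cases "i \<in> I \<and> s \<in> T i")
    case True
    \<comment> \<open>All exponentials of player \<open>i\<close> carry this common factor, which
      normalisation cancels.\<close>
    define c where "c = exp (v $ i $ b i) / ?x $ i $ b i"
    have pos: "0 < ?x $ i $ r" if "r \<in> T i" for r using x True that by (auto simp: face_interior_def)
    have c: "0 < c" using pos[of "b i"] b_in True by (simp add: c_def)
    have e: "exp (log_orbit v t $ i $ r) = c * ?x $ i $ r" if "r \<in> T i" for r
      using that True pos[OF that] pos[of "b i"] b_in[of i]
      by (simp add: log_orbit_def exp_add exp_diff c_def)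
    then have "(\<Sum>r\<in>T i. exp (log_orbit v t $ i $ r)) = c"
      using face_sum[OF xf, of i] True by (simp flip: sum_distrib_left)
    then show ?thesis using e[of s] True c by (simp add: softmax_def)
  qed (use face_D(4)[OF xf] in \<open>auto simp: softmax_def\<close>)
  then show ?thesis by (simp add: vec_eq_iff)
qed

lemma log_orbit_deriv: "(log_orbit v has_vector_derivative log_field (log_orbit v t)) (at t)"
proof -
  have "((\<lambda>t. log_orbit v t $ i $ s) has_real_derivative log_field (log_orbit v t) $ i $ s) (at t)" for i s
  proof (cases "i \<in> I \<and> s \<in> T i")
    case True
    then have "0 < softmax v $ i $ s" "0 < softmax v $ i $ b i"
      using softmax_in[of v] b_in by (auto simp: face_interior_def)
    from DERIV_add[OF log_ratio_deriv[OF softmax_X this] DERIV_const[of "v $ i $ b i"]]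
    show ?thesis using True by (simp add: log_field_def softmax_log_orbit) (simp add: log_orbit_def)
  qed (auto simp: log_orbit_def log_field_def)
  then show ?thesis unfolding has_vector_derivative_def
    by (subst has_derivative_componentwise_within)
      (auto simp: Basis_vec2 inner_axis_axis2 has_real_derivative_iff_has_vector_derivative
        has_vector_derivative_def)
qed

text \<open>\<open>log_orbit\<close> is constant in the coordinates that \<open>softmax\<close> ignores and in those that normalise its
  additive freedom. Confining them to the unit interval gives the lift of a set that stays away from
  the boundary of the face a finite volume.\<close>

definition lift :: "(real^'s^'i) set \<Rightarrow> (real^'s^'i) set" where
  "lift A = {v. softmax v \<in> A \<and>
     (\<forall>i s. i \<notin> I \<or> s \<notin> T i \<or> s = b i \<longrightarrow> 0 \<le> v $ i $ s \<and> v $ i $ s \<le> 1)}"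

lemma lift_face: "lift (A \<inter> face) = lift A"
  using softmax_face by (auto simp: lift_def)

lemma lift_borel:
  assumes "open A" shows "lift A \<in> sets borel"
proof -
  have "lift A = softmax -` A \<inter> (\<Inter>i. \<Inter>s. {v. i \<notin> I \<or> s \<notin> T i \<or> s = b i \<longrightarrow> 0 \<le> v $ i $ s \<and> v $ i $ s \<le> 1})"
    by (auto simp: lift_def)
  moreover have "open (softmax -` A)"
    using continuous_softmax assms by (simp add: continuous_on_open_vimage)
  moreover have "closed (\<Inter>i. \<Inter>s. {v::real^'s^'i. i \<notin> I \<or> s \<notin> T i \<or> s = b i \<longrightarrow> 0 \<le> v $ i $ s \<and> v $ i $ s \<le> 1})"
    by (intro closed_INT ballI closed_Collect_imp closed_Collect_conj closed_Collect_le
        continuous_intros open_Collect_const)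
  ultimately show ?thesis by (auto intro: borel_open borel_closed)
qed

text \<open>Taking logarithms inverts \<open>softmax\<close>; the constant 1 / 2 puts the
  coordinates confined by \<open>lift\<close> strictly inside the unit interval.\<close>

lemma softmax_surj:
  assumes "y \<in> face_interior"
  obtains v where "softmax v = y"
    "\<And>i s. i \<notin> I \<or> s \<notin> T i \<or> s = b i \<Longrightarrow> v $ i $ s = 1 / 2"
proof -
  define v where "v = (\<chi> i s. if i \<in> I \<and> s \<in> T i then ln (y $ i $ s) - ln (y $ i $ b i) + 1 / 2 else 1 / 2)"
  have y: "y \<in> face" using assms by (simp add: face_interior_def)
  have "softmax v $ i $ s = y $ i $ s" for i s
  proof (cases "i \<in> I \<and> s \<in> T i")
    case True
    define c where "c = exp (1 / 2) / y $ i $ b i"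
    have pos: "0 < y $ i $ r" if "r \<in> T i" for r using assms True that by (auto simp: face_interior_def)
    have c: "0 < c" using pos[of "b i"] b_in True by (simp add: c_def)
    have e: "exp (v $ i $ r) = c * y $ i $ r" if "r \<in> T i" for r
      using that True pos[OF that] pos[of "b i"] b_in[of i] by (simp add: v_def exp_add exp_diff c_def)
    then have "(\<Sum>r\<in>T i. exp (v $ i $ r)) = c"
      using face_sum[OF y, of i] True by (simp flip: sum_distrib_left)
    then show ?thesis using e[of s] True c by (simp add: softmax_def)
  qed (use face_D(4)[OF y] in \<open>auto simp: softmax_def\<close>)
  moreover have "v $ i $ s = 1 / 2" if "i \<notin> I \<or> s \<notin> T i \<or> s = b i" for i s
    using that by (auto simp: v_def)
  ultimately show thesis by (intro that[of v]) (simp_all add: vec_eq_iff)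
qed

lemma lift_open_nonnull:
  assumes "open A" "y \<in> A" "y \<in> face_interior"
  shows "emeasure lborel (lift A) \<noteq> 0"
proof
  assume null: "emeasure lborel (lift A) = 0"
  obtain v where v: "softmax v = y" "\<And>i s. i \<notin> I \<or> s \<notin> T i \<or> s = b i \<Longrightarrow> v $ i $ s = 1 / 2"
    by (rule softmax_surj[OF assms(3)]) blast
  \<comment> \<open>Replacing the closed unit intervals of \<open>lift A\<close> by open ones leaves
    an open set around \<open>v\<close>, which cannot be null.\<close>
  define W where "W = softmax -` A \<inter> (\<Inter>i. \<Inter>s. {v. i \<notin> I \<or> s \<notin> T i \<or> s = b i \<longrightarrow> 0 < v $ i $ s \<and> v $ i $ s < 1})"
  have "open (\<Inter>i. \<Inter>s. {v::real^'s^'i. i \<notin> I \<or> s \<notin> T i \<or> s = b i \<longrightarrow> 0 < v $ i $ s \<and> v $ i $ s < 1})"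
    by (intro open_INT ballI open_Collect_imp open_Collect_conj open_Collect_less
        continuous_intros closed_Collect_const finite)
  moreover have "open (softmax -` A)"
    using continuous_softmax assms(1) by (simp add: continuous_on_open_vimage)
  ultimately have W: "open W" by (auto simp: W_def)
  have "0 < v $ i $ s \<and> v $ i $ s < 1" if "i \<notin> I \<or> s \<notin> T i \<or> s = b i" for i s
    using v(2)[OF that] by simp
  then have "v \<in> W" using v(1) assms(2) by (simp add: W_def)
  have "W \<subseteq> lift A" by (auto simp: W_def lift_def less_imp_le)
  then have "emeasure lborel W = 0"
    using null emeasure_mono[of W "lift A" lborel] lift_borel[OF assms(1)] by simp
  then have "negligible W"
    using W by (simp add: negligible_iff_emeasure0 borel_open)
  then show False using open_not_negligible[OF W] \<open>v \<in> W\<close> by blast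
qed

text \<open>On \<open>A \<inter> face\<close> the logarithms of the active coordinates lie between
  \<open>ln \<eta>\<close> and 0, and an active entry of \<open>v\<close> is a difference of two of
  them plus a reference entry in the unit interval. So the lift is bounded.\<close>

lemma lift_finite_measure:
  assumes "0 < \<eta>" and A: "\<And>y i s. y \<in> A \<inter> face \<Longrightarrow> i \<in> I \<Longrightarrow> s \<in> T i \<Longrightarrow> \<eta> \<le> y $ i $ s"
  shows "emeasure lborel (lift A) < \<infinity>"
proof (rule emeasure_bounded_finite)
  have "\<bar>v $ i $ s\<bar> \<le> 1 + \<bar>ln \<eta>\<bar>" if v: "v \<in> lift A" for v i s
  proof (cases "i \<in> I \<and> s \<in> T i")
    case True
    have sm: "\<eta> \<le> softmax v $ i $ r" "softmax v $ i $ r \<le> 1" if "r \<in> T i" for r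
      using A[of "softmax v" i r] face_D(3)[OF softmax_face] softmax_face v True that by (auto simp: lift_def)
    have l: "\<bar>ln (softmax v $ i $ r)\<bar> \<le> - ln \<eta>" "ln (softmax v $ i $ r) \<le> 0" if "r \<in> T i" for r
    proof -
      have "ln \<eta> \<le> ln (softmax v $ i $ r)" "0 < softmax v $ i $ r"
        using sm[OF that] assms(1) by (auto intro!: ln_mono)
      moreover from this show "ln (softmax v $ i $ r) \<le> 0" using sm[OF that] by simp
      ultimately show "\<bar>ln (softmax v $ i $ r)\<bar> \<le> - ln \<eta>" by simp
    qed
    have "v $ i $ s = ln (softmax v $ i $ s) - ln (softmax v $ i $ b i) + v $ i $ b i"
      using True b_in[of i] sum_exp_pos[of i v] by (simp add: softmax_def ln_div)
    moreover have "0 \<le> v $ i $ b i" "v $ i $ b i \<le> 1" using v by (auto simp: lift_def)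
    ultimately show ?thesis using l[of s] l[of "b i"] True b_in[of i] by linarith
  next
    case False
    then have "0 \<le> v $ i $ s \<and> v $ i $ s \<le> 1" using v unfolding lift_def by blast
    then show ?thesis by linarith
  qed
  then have "norm v \<le> coords * (1 + \<bar>ln \<eta>\<bar>)" if "v \<in> lift A" for v
    using that by (intro norm_le_coords) auto
  then show "bounded (lift A)" by (auto simp: bounded_iff)
qed

text \<open>A volume-preserving approximation of the lifted flow maps \<open>lift A\<close> into
  \<open>lift B\<close>; the margin \<delta> in the hypothesis absorbs its error, scaled by the
  Lipschitz constant \<open>coords * 2\<close> of \<open>softmax\<close>.\<close>

lemma lift_measure_le:
  assumes "0 < \<tau>" "0 < \<delta>" and B: "open B" "\<And>u y. u \<in> A \<Longrightarrow> dist (\<phi> u \<tau>) y < \<delta> \<Longrightarrow> y \<in> B"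
  shows "emeasure lborel (lift A) \<le> emeasure lborel (lift B)"
proof -
  define \<delta>' where "\<delta>' = \<delta> / (coords * 2)"
  have "0 < \<delta>'" using assms(2) coords_pos by (simp add: \<delta>'_def)
  obtain \<psi> where \<psi>: "lborel_preserving \<psi>" "\<And>v. dist (\<psi> v) (log_orbit v \<tau>) < \<delta>'"
    "\<And>v e. e \<in> Basis \<Longrightarrow> (\<And>w. log_field w \<bullet> e = 0) \<Longrightarrow> \<psi> v \<bullet> e = v \<bullet> e"
    using log.flow_limit_of_lborel_preserving[of log_orbit \<tau> \<delta>'] log_orbit_deriv log_orbit_0
      assms(1) \<open>0 < \<delta>'\<close> by blast
  show ?thesis
  proof (rule emeasure_le_of_lborel_preserving[OF \<psi>(1) lift_borel[OF B(1)]])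
    fix v assume v: "v \<in> lift A"
    have "dist (softmax (\<psi> v)) (\<phi> (softmax v) \<tau>) \<le> coords * 2 * dist (\<psi> v) (log_orbit v \<tau>)"
      using softmax_lipschitz[of "\<psi> v" "log_orbit v \<tau>"] by (simp add: softmax_log_orbit)
    also have "\<dots> < coords * 2 * \<delta>'" using \<psi>(2)[of v] coords_pos by simp
    also have "\<dots> = \<delta>" using coords_pos by (simp add: \<delta>'_def)
    finally have "softmax (\<psi> v) \<in> B"
      using v by (intro B(2)[of "softmax v"]) (auto simp: lift_def dist_commute)
    \<comment> \<open>\<open>log_field\<close> vanishes in the coordinates that \<open>lift\<close>
      confines, so \<psi> keeps them in the unit interval.\<close>
    moreover have "\<psi> v $ i $ s = v $ i $ s" if "i \<notin> I \<or> s \<notin> T i \<or> s = b i" for i s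
    proof -
      have "axis i (axis s 1) \<in> (Basis :: (real^'s^'i) set)" by (auto simp: Basis_vec2)
      then show ?thesis
        using \<psi>(3)[of "axis i (axis s 1)" v] that by (auto simp: inner_axis_axis2 log_field_def)
    qed
    ultimately show "\<psi> v \<in> lift B" using v by (auto simp: lift_def)
  qed
qed

section \<open>Geometry of the face and the trapping argument\<close>

lemma convex_face: "convex face"
  using convex_strategy_space[of G] by (auto simp: face_def convex_def)

lemma closed_face: "closed face"
proof -
  have "face = (\<Inter>i\<in>I. {x. (\<Sum>s\<in>T i. x $ i $ s) = 1}) \<inter> (\<Inter>i. \<Inter>s. {x. 0 \<le> x $ i $ s})
      \<inter> (\<Inter>i. \<Inter>s. {x. i \<notin> I \<or> s \<notin> T i \<longrightarrow> x $ i $ s = 0})"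
    by (auto intro: faceI simp: face_D face_sum)
  moreover have "closed \<dots>"
    by (intro closed_Int closed_INT ballI closed_Collect_imp closed_Collect_le closed_Collect_eq
        continuous_intros open_Collect_const)
  ultimately show ?thesis by simp
qed

text \<open>Player \<open>i\<close> transfers the whole probability of \<open>s\<close> to
  \<open>t\<close>; the displacement is that probability times a difference of two unit
  vectors.\<close>

lemma face_move_mass:
  assumes y: "y \<in> face" and i: "i \<in> I" and st: "s \<in> T i" "t \<in> T i" "s \<noteq> t"
  obtains z where "z \<in> face" "z $ i $ s = 0" "dist y z \<le> 2 * y $ i $ s"
proof -
  define z :: "real^'s^'i" where "z = y + y $ i $ s *\<^sub>R (axis i (axis t 1) - axis i (axis s 1))"
  have z: "z $ j $ r = y $ j $ r + y $ i $ s * (if j = i then (if r = t then 1 else 0) - (if r = s then 1 else 0) else 0)" for j r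
    by (simp add: z_def axis_def)
  have "(\<Sum>r\<in>T j. z $ j $ r) = 1" if "j \<in> I" for j
    using face_sum[OF y that] st
    by (cases "j = i") (simp_all add: z sum.distrib sum_distrib_left[symmetric] sum_subtractf)
  then have "z \<in> face"
    using face_D[OF y] st by (intro faceI) (auto simp: z i)
  moreover have "z $ i $ s = 0" using st by (simp add: z)
  moreover have "dist y z \<le> 2 * y $ i $ s"
  proof -
    have "norm (axis i (axis t 1) - axis i (axis s 1) :: real^'s^'i) \<le> 2"
      by (rule order_trans[OF norm_triangle_ineq4], subst (1 2) norm_Basis) (auto simp: Basis_vec2)
    then show ?thesis
      using mult_left_mono[of "norm (axis i (axis t 1) - axis i (axis s 1) :: real^'s^'i)" 2 "y $ i $ s"] face_D(2)[OF y]
      by (simp add: dist_norm z_def norm_minus_commute mult.commute)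
  qed
  ultimately show thesis by (rule that)
qed

text \<open>Otherwise the reachable set stays off the boundary and is mapped into itself with room
  to spare, which volume preservation forbids on finite volume. The strategy \<open>s0\<close>
  ensures that the face has a boundary.\<close>

lemma chain_to_face_boundary:
  assumes x: "x \<in> face_interior" and i0: "i0 \<in> I" "s0 \<in> T i0" "s0 \<noteq> b i0"
    and "0 < \<epsilon>" "0 < \<tau>"
  obtains z i s where "chain X \<phi> \<epsilon> \<tau> x z" "z \<in> face" "i \<in> I" "s \<in> T i" "z $ i $ s = 0"
proof (rule ccontr)
  assume neg: "\<not> thesis"
  note found = that
  have no: "0 < z $ i $ s" if "chain X \<phi> \<epsilon> \<tau> x z" "z \<in> face" "i \<in> I" "s \<in> T i" for z i s
    using neg found[of z i s] that face_D(2)[OF that(2), of i s] by (auto simp: less_le)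
  \<comment> \<open>One half of the tolerance is for the chains that define \<open>U\<close>, the
    other for a final move to the boundary.\<close>
  define \<epsilon>' where "\<epsilon>' = \<epsilon> / 2"
  have \<epsilon>': "0 < \<epsilon>'" "\<epsilon>' + \<epsilon>' = \<epsilon>" using \<open>0 < \<epsilon>\<close> by (simp_all add: \<epsilon>'_def)
  \<comment> \<open>Points within one final jump from \<open>x\<close> or from a point already
    reached by a chain; a union of balls, hence open.\<close>
  define U where "U = (\<Union>w\<in>{w \<in> X. w = x \<or> chain X \<phi> \<epsilon>' \<tau> x w}. \<Union>t\<in>{\<tau>..}. ball (\<phi> w t) \<epsilon>')"
  have "open U" by (auto simp: U_def)
  have xX: "x \<in> X" using x by (auto simp: face_interior_def face_def)
  have U_chain: "chain X \<phi> \<epsilon>' \<tau> x y" if "y \<in> U" "y \<in> face" for y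
    using that unfolding U_def by (auto intro: chain_append simp: face_D)
  have U_nonempty: "\<phi> x \<tau> \<in> U \<inter> face"
    using \<epsilon>' xX flow_face_interior[OF x, of \<tau>] unfolding U_def face_interior_def
    by (intro IntI UN_I[of x] UN_I[of \<tau>]) auto
  \<comment> \<open>A coordinate below \<eta> could be emptied by a move shorter than \<epsilon>'.
    The cap 1 excludes a player with a single active strategy, whose coordinate equals 1.\<close>
  define \<eta> where "\<eta> = min 1 (\<epsilon>' / 4)"
  have \<eta>: "0 < \<eta>" "\<eta> \<le> 1" "2 * \<eta> < \<epsilon>'" using \<epsilon>' by (auto simp: \<eta>_def min_def)
  have U_bound: "\<eta> \<le> y $ i $ s" if y: "y \<in> U \<inter> face" and i: "i \<in> I" and s: "s \<in> T i" for y i s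
  proof (rule ccontr)
    assume small: "\<not> \<eta> \<le> y $ i $ s"
    have "T i \<noteq> {s}"
      using face_sum[of y i] y i small \<eta>(2) by auto
    then obtain t where t: "t \<in> T i" "s \<noteq> t" using s by blast
    obtain z where z: "z \<in> face" "z $ i $ s = 0" "dist y z \<le> 2 * y $ i $ s"
      using face_move_mass[of y i s t] y i s t by blast
    have "dist y z < \<epsilon>'" using z(3) small \<eta>(3) by linarith
    then have "chain X \<phi> \<epsilon> \<tau> x z"
      using chain_perturb_end[OF U_chain[of y], where z = z and \<epsilon>' = \<epsilon>'] y z \<epsilon>' by (auto simp: face_D)
    then show False using no[of z i s] z i s by simp
  qed
  have trap: "y \<in> U" if "u \<in> U \<inter> face" "dist (\<phi> u \<tau>) y < \<epsilon>'" for u y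
    using that U_chain[of u] unfolding U_def
    by (intro UN_I[of u] UN_I[of \<tau>]) (auto simp: face_D)
  \<comment> \<open>The tolerance is halved again, so that even limits in the face of points of
    \<open>N\<close> remain in \<open>U\<close>.\<close>
  define N where "N = (\<Union>u\<in>U \<inter> face. ball (\<phi> u \<tau>) (\<epsilon>' / 2))"
  have "open N" by (auto simp: N_def)
  \<comment> \<open>Otherwise \<open>U \<inter> face\<close> would be closed and relatively open in
    the connected face, hence all of it, including boundary points.\<close>
  have "\<not> U \<inter> face \<subseteq> closure (N \<inter> face)"
  proof
    assume sub: "U \<inter> face \<subseteq> closure (N \<inter> face)"
    have "closure (N \<inter> face) \<subseteq> U \<inter> face"
    proof
      fix y assume y: "y \<in> closure (N \<inter> face)"
      then have "y \<in> face" using closed_face closure_mono[of "N \<inter> face" face] by auto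
      obtain y' where "y' \<in> N" "dist y' y < \<epsilon>' / 2"
        using y \<epsilon>' closure_approachable[of y "N \<inter> face"] by (metis half_gt_zero IntD1)
      then obtain u where "u \<in> U \<inter> face" "dist (\<phi> u \<tau>) y' < \<epsilon>' / 2" "dist y' y < \<epsilon>' / 2"
        by (auto simp: N_def)
      then have "u \<in> U \<inter> face" "dist (\<phi> u \<tau>) y < \<epsilon>'"
        using dist_triangle[of "\<phi> u \<tau>" y y'] by auto
      then show "y \<in> U \<inter> face" using trap \<open>y \<in> face\<close> by blast
    qed
    then have "closed (U \<inter> face)" using sub by (metis closed_closure subset_antisym)
    then have "closedin (top_of_set face) (U \<inter> face)"
      by (simp add: closed_subset)
    moreover have "openin (top_of_set face) (U \<inter> face)"
      using openin_open_Int[OF \<open>open U\<close>, of face] by (simp add: Int_commute)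
    ultimately have "U \<inter> face = face"
      using convex_connected[OF convex_face] U_nonempty unfolding connected_clopen by blast
    moreover obtain z where "z \<in> face" "z $ i0 $ s0 = 0"
      using face_move_mass[of "\<phi> x \<tau>" i0 s0 "b i0"] U_nonempty i0 b_in by auto
    ultimately show False using U_bound[of z i0 s0] i0 \<eta> by auto
  qed
  then obtain y where y: "y \<in> U" "y \<in> face" "y \<notin> closure (N \<inter> face)" by blast
  define W where "W = U - closure (N \<inter> face)"
  have W: "open W" "y \<in> W" using \<open>open U\<close> y by (auto simp: W_def)
  have "y \<in> face_interior"
    using U_bound[of y] y \<eta>(1) by (fastforce simp: face_interior_def)
  have "lift N \<inter> lift W = {}"
    using closure_subset[of "N \<inter> face"] softmax_face by (auto simp: lift_def W_def)
  moreover have "N \<subseteq> U"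
    using trap \<epsilon>'(1) by (force simp: N_def)
  then have "lift N \<union> lift W \<subseteq> lift U" by (auto simp: lift_def W_def)
  ultimately have "emeasure lborel (lift N) + emeasure lborel (lift W) \<le> emeasure lborel (lift U)"
    using lift_borel \<open>open N\<close> \<open>open U\<close> W(1)
    by (subst plus_emeasure) (auto intro: emeasure_mono)
  also have "\<dots> = emeasure lborel (lift (U \<inter> face))" by (simp add: lift_face)
  \<comment> \<open>Volume preservation: the time-\<tau> map sends \<open>U \<inter> face\<close>
    into \<open>N\<close> with margin \<open>\<epsilon>' / 2\<close>. So \<open>lift W\<close> adds
    nothing to a finite volume, although it is not null.\<close>
  also have "\<dots> \<le> emeasure lborel (lift N)"
    using \<open>open N\<close> \<epsilon>' assms(6)
    by (intro lift_measure_le[of \<tau> "\<epsilon>' / 2"]) (auto simp: N_def)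
  finally have "emeasure lborel (lift N) + emeasure lborel (lift W) \<le> emeasure lborel (lift N)" .
  moreover have "emeasure lborel (lift N) < \<infinity>"
  proof -
    have "emeasure lborel (lift N) \<le> emeasure lborel (lift U)"
      using \<open>lift N \<union> lift W \<subseteq> lift U\<close> lift_borel \<open>open U\<close> by (intro emeasure_mono) auto
    also have "\<dots> < \<infinity>" using U_bound \<eta>(1) by (intro lift_finite_measure[of \<eta>]) auto
    finally show ?thesis .
  qed
  moreover have "emeasure lborel (lift W) \<noteq> 0"
    using lift_open_nonnull[OF W \<open>y \<in> face_interior\<close>] .
  ultimately show False
    using ennreal_add_left_cancel_le[of "emeasure lborel (lift N)" "emeasure lborel (lift W)" 0] by auto
qed

end

section \<open>Descent through supports to a pure profile\<close>

context replicator
begin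

text \<open>A boundary point of the face spanned by the support of \<open>x\<close> has strictly
  smaller support, so finitely many uses of \<open>chain_to_face_boundary\<close> end at a
  vertex.\<close>

lemma chain_to_pure:
  assumes "x \<in> X" "0 < \<epsilon>" "0 < \<tau>"
  obtains p where "p \<in> profiles G" "chain X \<phi> \<epsilon> \<tau> x (pure_point G p)"
proof -
  have "\<exists>p\<in>profiles G. chain X \<phi> \<epsilon> \<tau> x (pure_point G p)"
    using assms(1)
  proof (induction "card {(i, s). 0 < x $ i $ s}" arbitrary: x rule: less_induct)
    case less
    define T where "T i = {s \<in> S i. 0 < x $ i $ s}" for i
    have T_ne: "T i \<noteq> {}" if "i \<in> I" for i
    proof
      assume "T i = {}"
      then have "(\<Sum>s\<in>S i. x $ i $ s) \<le> 0" by (intro sum_nonpos) (auto simp: T_def not_less)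
      then show False using X_D(3)[OF less.prems that] by simp
    qed
    define p where "p = (\<lambda>i\<in>I. SOME s. s \<in> T i)"
    have p: "p i \<in> T i" if "i \<in> I" for i using T_ne[OF that] that by (simp add: p_def some_in_eq)
    interpret replicator_face G \<phi> T p
      using p by unfold_locales (auto simp: T_def)
    have x: "x \<in> face_interior"
      using less.prems X_D(1)[OF less.prems] by (auto simp: face_interior_def face_def T_def order.antisym not_less)
    have pp: "p \<in> profiles G" using p by (auto simp: profiles_def p_def T_def)
    show ?case
    proof (cases "\<exists>i\<in>I. \<exists>s\<in>T i. s \<noteq> p i")
      case False
      then have "T i = {p i}" if "i \<in> I" for i using p[OF that] that by blast
      then have "x = pure_point G p"
        using face_sum[of x] x less.prems by (intro eq_pure_pointI pp) (auto simp: face_interior_def)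
      then show ?thesis using chain_pure_point_refl[OF pp assms(2)] pp by blast
    next
      case True
      then obtain z i s where z: "chain X \<phi> \<epsilon> \<tau> x z" "z \<in> face" "i \<in> I" "s \<in> T i" "z $ i $ s = 0"
        using chain_to_face_boundary[OF x _ _ _ assms(2,3)] by blast
      have "{(i, s). 0 < z $ i $ s} \<subset> {(i, s). 0 < x $ i $ s}"
      proof
        show "{(i, s). 0 < z $ i $ s} \<subseteq> {(i, s). 0 < x $ i $ s}"
          using face_D(4)[OF z(2)] by (force simp: T_def)
        have "0 < x $ i $ s" using z(4) by (simp add: T_def)
        then have "(i, s) \<in> {(i, s). 0 < x $ i $ s} - {(i, s). 0 < z $ i $ s}" using z(5) by simp
        then show "{(i, s). 0 < z $ i $ s} \<noteq> {(i, s). 0 < x $ i $ s}" by blast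
      qed
      then have "card {(i, s). 0 < z $ i $ s} < card {(i, s). 0 < x $ i $ s}"
        by (intro psubset_card_mono) auto
      then obtain p where "p \<in> profiles G" "chain X \<phi> \<epsilon> \<tau> z (pure_point G p)"
        using less.hyps[of z] face_D(1)[OF z(2)] by blast
      then show ?thesis using chain_trans[OF z(1)] by blast
    qed
  qed
  then show thesis using that by blast
qed

end

section \<open>Response arcs and pure Nash equilibria\<close>

lemma comparable_sym: "comparable G i p q \<Longrightarrow> comparable G i q p"
  by (auto simp: comparable_def)

lemma comparable_unique: "comparable G i p q \<Longrightarrow> comparable G j p q \<Longrightarrow> i = j"
  by (auto simp: comparable_def)

lemma comparable_eq_upd:
  assumes "comparable G i p q" shows "q = p(i := q i)"
proof (rule PiE_ext)
  show "q \<in> PiE (players G) (strategies G)" using assms by (simp add: comparable_def profiles_def)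
  show "p(i := q i) \<in> PiE (players G) (strategies G)"
    using assms by (auto simp: comparable_def profiles_def PiE_def Pi_def extensional_def)
qed (use assms in \<open>auto simp: comparable_def\<close>)

text \<open>Only increase along strict improvements is asked for: this part of an exact potential
  survives an isomorphism of response graphs.\<close>

definition ordinal_potential :: "('i, 's) game \<Rightarrow> (('i \<Rightarrow> 's) \<Rightarrow> real) \<Rightarrow> bool" where
  "ordinal_potential G Q \<longleftrightarrow>
     (\<forall>i p q. comparable G i p q \<and> utility G p i < utility G q i \<longrightarrow> Q p < Q q)"

text \<open>A strict improvement is an arc without a reverse arc. An isomorphism preserves this, and
  in the potential game an arc with equal potentials at its ends would have a reverse arc.\<close>

lemma preference_potential_ordinal:
  assumes "preference_potential G"
  obtains Q where "ordinal_potential G Q"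
proof -
  obtain H :: "(nat, nat) game" and P f
    where P: "\<And>i p q. comparable H i p q \<Longrightarrow> utility H p i - utility H q i = P p - P q"
      and iso: "pre_digraph.digraph_isomorphism (response_graph G) f"
      and H: "response_graph H = app_iso f (response_graph G)"
    using assms unfolding preference_potential_def potential_game_def digraph_iso_def by metis
  let ?v = "iso_verts f"
  \<comment> \<open>In both graphs the arcs are pairs with the projections as tail and head, so the
    isomorphism acts on arcs through its action on vertices.\<close>
  have ends: "iso_tail f = fst" "iso_head f = snd"
    using arg_cong[OF H, of tail] arg_cong[OF H, of head] by (simp_all add: response_graph_def)
  have arc: "iso_arcs f (p, q) = (?v p, ?v q)" if "(p, q) \<in> arcs (response_graph G)" for p q
    using pre_digraph.iso_verts_tail[OF iso that] pre_digraph.iso_verts_head[OF iso that]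
    by (simp add: ends response_graph_def prod_eq_iff)
  have arcs_H: "arcs (response_graph H) = iso_arcs f ` arcs (response_graph G)"
    by (simp add: H)
  have inj: "inj_on ?v (profiles G)"
    using pre_digraph.digraph_isomorphism_inj_on_verts[OF iso] by (simp add: response_graph_def)
  have "P (?v p) < P (?v q)" if c: "comparable G i p q" and u: "utility G p i < utility G q i" for i p q
  proof -
    have "(p, q) \<in> arcs (response_graph G)" using c u by (auto simp: response_graph_def)
    then have "(?v p, ?v q) \<in> arcs (response_graph H)" using arc arcs_H by force
    then obtain j where j: "comparable H j (?v p) (?v q)" "utility H (?v p) j \<le> utility H (?v q) j"
      by (auto simp: response_graph_def)
    have "P (?v p) \<noteq> P (?v q)"
    proof
      assume "P (?v p) = P (?v q)"
      then have "(?v q, ?v p) \<in> arcs (response_graph H)"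
        using P[OF j(1)] comparable_sym[OF j(1)] by (auto simp: response_graph_def)
      then obtain p' q' where p': "(p', q') \<in> arcs (response_graph G)" "(?v q, ?v p) = iso_arcs f (p', q')"
        unfolding arcs_H by auto
      then have "?v p' = ?v q" "?v q' = ?v p" using arc by auto
      then have "p' = q" "q' = p"
        using inj c p'(1) by (auto simp: response_graph_def comparable_def dest: inj_onD)
      then obtain k where "comparable G k q p" "utility G q k \<le> utility G p k"
        using p'(1) by (auto simp: response_graph_def)
      then show False using u comparable_unique[OF _ comparable_sym[OF c]] by fastforce
    qed
    then show ?thesis using P[OF j(1)] j(2) by simp
  qed
  then show thesis by (intro that[of "P \<circ> ?v"]) (auto simp: ordinal_potential_def)
qed

section \<open>Climbing along response arcs to an equilibrium\<close>

context replicator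
begin

lemma finite_profiles: "finite (profiles G)"
  using fin by (auto simp: profiles_def finite_game_def intro: finite_PiE)

text \<open>Two jumps suffice: a small one from the rest point onto the edge towards
  \<open>q\<close>, then a long run along the edge, on which the logarithmic ratio of
  \<open>q i\<close> to \<open>p i\<close> grows at a constant positive rate.\<close>

lemma chain_response_arc:
  assumes c: "comparable G i p q" and u: "utility G p i < utility G q i" and "0 < \<epsilon>"
  shows "chain X \<phi> \<epsilon> \<tau> (pure_point G p) (pure_point G q)"
proof -
  define r s where "r = p i" and "s = q i"
  have q: "q = p(i := s)" using comparable_eq_upd[OF c] by (simp add: s_def)
  have i: "i \<in> I" and p: "p \<in> profiles G" "q \<in> profiles G" and rs: "r \<noteq> s" "r \<in> S i" "s \<in> S i"
    using c by (auto simp: comparable_def r_def s_def profiles_def)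
  define d :: "real^'s^'i" where "d = axis i (axis r 1) - axis i (axis s 1)"
  have d: "d $ j $ t = (if j = i then (if t = r then 1 else 0) - (if t = s then 1 else 0) else 0)" for j t
    by (simp add: d_def axis_def)
  have "norm (axis i (axis r 1) :: real^'s^'i) = 1" for r
    by (rule norm_Basis) (auto simp: Basis_vec2)
  then have norm_d: "norm d \<le> 2"
    using norm_triangle_ineq4[of "axis i (axis r 1) :: real^'s^'i" "axis i (axis s 1)"] by (simp add: d_def)
  have pq: "pure_point G p = pure_point G q + d"
    using i rs by (auto simp: vec_eq_iff d pure_point_def q r_def)
  \<comment> \<open>The probability shifted to \<open>s\<close>: below 1 to keep \<open>r\<close> in
    the support, and below \<open>\<epsilon> / 2\<close> because
    \<open>norm d \<le> 2\<close>.\<close>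
  define a where "a = min (1 / 2) (\<epsilon> / 4)"
  have a: "0 < a" "a < 1" "2 * a < \<epsilon>" using assms(3) by (auto simp: a_def min_def)
  define x where "x = (1 - a) *\<^sub>R pure_point G p + a *\<^sub>R pure_point G q"
  have x: "x \<in> X" unfolding x_def
    using a by (intro convexD[OF convex_strategy_space]) (auto intro: pure_point_in p)
  have "pure_point G p - x = a *\<^sub>R d" by (simp add: x_def pq algebra_simps)
  then have "dist (pure_point G p) x \<le> a * 2"
    using norm_d a by (simp add: dist_norm)
  then have first: "chain X \<phi> \<epsilon> \<tau> (pure_point G p) x"
    using a x p by (intro chain_single[of _ _ _ _ \<tau>]) (auto simp: flow_pure_point pure_point_in)
  have x_nth: "x $ j $ t = pure_point G q $ j $ t + (1 - a) * d $ j $ t" for j t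
    by (simp add: x_def pq algebra_simps)
  have pos: "0 < x $ i $ r" "0 < x $ i $ s"
    using i rs a by (auto simp: x_nth d pure_point_def q)
  \<comment> \<open>Coordinates off the edge stay zero, so the probability of \<open>r\<close>
    determines the whole point.\<close>
  have flow_x: "\<phi> x t = pure_point G q + \<phi> x t $ i $ r *\<^sub>R d" for t
  proof -
    have zero: "\<phi> x t $ j $ l = 0" if "j \<in> I" "l \<noteq> q j" "j = i \<Longrightarrow> l \<noteq> r" for j l
      using that by (intro coord_zero x) (auto simp: x_nth d pure_point_def s_def)
    have "\<phi> x t $ j $ l = (pure_point G q + \<phi> x t $ i $ r *\<^sub>R d) $ j $ l" for j l
    proof (cases "j \<in> I")
      case True
      have qj: "q j \<in> S j" using p True by (auto simp: profiles_def)
      have sum: "(\<Sum>l\<in>S j. \<phi> x t $ j $ l) = 1" using X_D(3)[OF flow_in[OF x] True] .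
      show ?thesis
      proof (cases "j = i")
        case [simp]: True
        have "(\<Sum>l\<in>S i. \<phi> x t $ i $ l) = (\<Sum>l\<in>{r, s}. \<phi> x t $ i $ l)"
          using zero[of i] i rs by (intro sum.mono_neutral_right) (auto simp: s_def)
        then have "\<phi> x t $ i $ r + \<phi> x t $ i $ s = 1" using sum rs by simp
        then show ?thesis using zero[of i l] i rs by (auto simp: d pure_point_def s_def)
      next
        case False
        have "(\<Sum>l\<in>S j. \<phi> x t $ j $ l) = (\<Sum>l\<in>{q j}. \<phi> x t $ j $ l)"
          using zero[of j] True False qj by (intro sum.mono_neutral_right) auto
        then show ?thesis using sum zero[of j l] True False by (auto simp: d pure_point_def)
      qed
    next
      case False
      then show ?thesis using X_D(4)[OF flow_in[OF x], of j l t] i by (auto simp: d pure_point_def)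
    qed
    then show ?thesis unfolding vec_eq_iff by blast
  qed
  define \<Delta> where "\<Delta> = utility G q i - utility G p i"
  have \<Delta>: "0 < \<Delta>" using u by (simp add: \<Delta>_def)
  have D: "D i s (\<phi> x t) - D i r (\<phi> x t) = \<Delta>" for t
  proof -
    have "\<phi> x t $ j = axis (p j) 1" if "j \<in> I - {i}" for j
      using that by (subst flow_x) (auto simp: vec_eq_iff d pure_point_def q axis_def)
    then have "D i l (\<phi> x t) = utility G (p(i := l)) i" if "l \<in> S i" for l
      using that by (intro D_pure p i)
    then show ?thesis using rs by (simp add: \<Delta>_def q r_def)
  qed
  define y where "y t = ln (\<phi> x t $ i $ s) - ln (\<phi> x t $ i $ r) - \<Delta> * t" for t
  have "(y has_real_derivative 0) (at t)" for t
    using DERIV_diff[OF log_ratio_deriv[OF x pos(2,1)] DERIV_cmult_Id[of \<Delta>], of t]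
    by (simp add: y_def[abs_def] D)
  then have y: "y t = y 0" for t by (rule DERIV_isconst_all[rule_format])
  \<comment> \<open>By this time the logarithm of the probability of \<open>r\<close> is at most
    \<open>ln (\<epsilon> / 2) - 1\<close>, since that of \<open>s\<close> is at most 0; the maximum
    respects the minimal duration \<tau>.\<close>
  define t where "t = max \<tau> ((1 - ln (\<epsilon> / 2) - y 0) / \<Delta>)"
  have "1 - ln (\<epsilon> / 2) - y 0 \<le> t * \<Delta>"
    using \<Delta> by (simp add: t_def pos_divide_le_eq[symmetric])
  moreover have flow_t: "\<phi> x t $ i $ s \<le> 1" "0 < \<phi> x t $ i $ s" "0 < \<phi> x t $ i $ r"
    using X_D(2)[OF flow_in[OF x]] pos coord_pos_iff[OF x] by auto
  moreover from flow_t have "ln (\<phi> x t $ i $ s) \<le> 0" by simp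
  ultimately have "ln (\<phi> x t $ i $ r) < ln (\<epsilon> / 2)"
    using y[of t] unfolding y_def mult.commute[of t] by linarith
  then have "\<phi> x t $ i $ r < \<epsilon> / 2"
    using flow_t(3) assms(3) by simp
  moreover have "dist (\<phi> x t) (pure_point G q) \<le> \<phi> x t $ i $ r * 2"
    using norm_d flow_t(3) by (subst flow_x) (simp add: dist_norm)
  ultimately have "chain X \<phi> \<epsilon> \<tau> x (pure_point G q)"
    by (intro chain_single[of _ _ _ _ t]) (auto simp: x p pure_point_in t_def)
  with first show ?thesis by (rule chain_trans)
qed

text \<open>Among the pure profiles reached by chains take one of maximal \<open>Q\<close>. A
  profitable deviation from it would be reached as well, by \<open>chain_response_arc\<close>, and
  would have larger \<open>Q\<close>.\<close>

lemma chain_to_nash: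
  assumes Q: "ordinal_potential G Q"
    and "x \<in> X" "0 < \<epsilon>" "0 < \<tau>"
  obtains p where "pure_nash G p" "chain X \<phi> \<epsilon> \<tau> x (pure_point G p)"
proof -
  define R where "R = {p \<in> profiles G. chain X \<phi> \<epsilon> \<tau> x (pure_point G p)}"
  have R: "finite R" "R \<noteq> {}"
    using finite_profiles chain_to_pure[OF assms(2-4)] by (auto simp: R_def)
  obtain p where p: "p \<in> R" "\<And>q. q \<in> R \<Longrightarrow> Q q \<le> Q p"
    using Max_in[of "Q ` R"] Max_ge[of "Q ` R"] R by (metis (no_types, lifting) finite_imageI image_iff image_is_empty)
  have "pure_nash G p"
  proof (rule ccontr)
    assume "\<not> pure_nash G p"
    then obtain i q where "comparable G i q p" "utility G p i < utility G q i"
      using p(1) by (auto simp: pure_nash_def R_def not_le)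
    then have q: "comparable G i p q" "utility G p i < utility G q i" by (auto intro: comparable_sym)
    then have "q \<in> R"
      using p(1) chain_response_arc[OF q assms(3)] chain_trans by (fastforce simp: R_def comparable_def)
    then show False using p(2) q Q unfolding ordinal_potential_def by fastforce
  qed
  then show thesis using that p(1) by (simp add: R_def)
qed

text \<open>In \<open>chain_to_nash\<close> the equilibrium depends on \<epsilon> and \<tau>. There
  are finitely many equilibria, so failure at each of them would yield one common pair that defeats
  them all.\<close>

lemma pseudo_orbit_to_nash:
  assumes Q: "ordinal_potential G Q"
    and "x \<in> X"
  obtains p where "pure_nash G p" "pseudo_orbit X \<phi> x (pure_point G p)"
proof (rule ccontr)
  assume "\<not> thesis"
  then have "\<forall>p. \<exists>\<epsilon> \<tau>. pure_nash G p \<longrightarrow> 0 < \<epsilon> \<and> 0 < \<tau> \<and> \<not> chain X \<phi> \<epsilon> \<tau> x (pure_point G p)"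
    using that unfolding pseudo_orbit_def by blast
  then obtain e t where et: "\<And>p. pure_nash G p \<Longrightarrow> 0 < e p \<and> 0 < t p \<and> \<not> chain X \<phi> (e p) (t p) x (pure_point G p)"
    by metis
  define F where "F = {p. pure_nash G p}"
  have F: "finite F" by (rule finite_subset[OF _ finite_profiles]) (auto simp: F_def pure_nash_def)
  define \<epsilon> where "\<epsilon> = Min (insert 1 (e ` F))"
  define \<tau> where "\<tau> = Max (insert 1 (t ` F))"
  have "0 < \<epsilon>" using F et by (auto simp: \<epsilon>_def F_def)
  moreover have "0 < \<tau>" using F by (auto simp: \<tau>_def Max_gr_iff)
  ultimately obtain p where p: "pure_nash G p" "chain X \<phi> \<epsilon> \<tau> x (pure_point G p)"
    by (rule chain_to_nash[OF Q \<open>x \<in> X\<close>])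
  have "\<epsilon> \<le> e p" "t p \<le> \<tau>"
    using F p(1) by (auto simp: \<epsilon>_def \<tau>_def F_def intro: Min_le Max_ge)
  then show False using chain_mono[OF p(2)] et[OF p(1)] by blast
qed

section \<open>Exponential attraction at a strict equilibrium\<close>

text \<open>Strictness makes every deviation from \<open>p\<close> lose a definite amount, by
  continuity also near \<open>p\<close>. The growth rate of \<open>p i\<close> weights these losses
  by the probabilities of the other strategies, which sum to \<open>1 - x $ i $ p i\<close>.\<close>

lemma growth_pure_nash:
  assumes "strict_game G" "pure_nash G p"
  obtains c \<rho> where "0 < c" "0 < \<rho>" "\<rho> \<le> 1 / 2"
    "\<And>x i. x \<in> X \<Longrightarrow> i \<in> I \<Longrightarrow> (\<And>j. j \<in> I \<Longrightarrow> 1 - \<rho> \<le> x $ j $ p j) \<Longrightarrow>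
      c * (1 - x $ i $ p i) \<le> growth i (p i) x"
proof -
  have p: "p \<in> profiles G" using assms(2) by (simp add: pure_nash_def)
  have pi: "p i \<in> S i" if "i \<in> I" for i using p that by (auto simp: profiles_def)
  define K where "K = {(i, s). i \<in> I \<and> s \<in> S i - {p i}}"
  define gap where "gap x = (\<lambda>(i, s). D i (p i) x - D i s x)" for x
  have gap_pos: "0 < gap (pure_point G p) k" if kK: "k \<in> K" for k
  proof -
    obtain i s where k: "k = (i, s)" "i \<in> I" "s \<in> S i" "s \<noteq> p i" using kK by (cases k) (simp add: K_def)
    have "D i l (pure_point G p) = utility G (p(i := l)) i" if "l \<in> S i" for l
      using that k(2) p by (intro D_pure) (auto simp: pure_point_nth)
    moreover have "comparable G i (p(i := s)) p"
      using p k by (auto simp: comparable_def profiles_def PiE_def Pi_def extensional_def)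
    then have "utility G (p(i := s)) i < utility G p i"
      using assms unfolding strict_game_def pure_nash_def by (metis less_le)
    ultimately show ?thesis using k pi[of i] by (simp add: gap_def)
  qed
  \<comment> \<open>Half of the least loss at \<open>p\<close>; the inserted 1 covers games without
    deviations.\<close>
  define c where "c = Min (insert 1 (gap (pure_point G p) ` K)) / 2"
  have "finite K" by simp
  then have c: "0 < c" using gap_pos by (auto simp: c_def)
  have "\<forall>\<^sub>F x in nhds (pure_point G p). \<forall>k\<in>K. c < gap x k"
  proof (rule eventually_ball_finite[OF \<open>finite K\<close>], rule ballI)
    fix k assume k: "k \<in> K"
    have "2 * c \<le> gap (pure_point G p) k" using k \<open>finite K\<close> by (auto simp: c_def intro: Min_le)
    then have "c < gap (pure_point G p) k" using c by linarith
    moreover have "continuous_on UNIV (\<lambda>x. gap x k)"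
      by (cases k) (auto simp: gap_def intro!: continuous_intros continuous_D)
    then have "((\<lambda>x. gap x k) \<longlongrightarrow> gap (pure_point G p) k) (at (pure_point G p))"
      by (simp add: continuous_on_eq_continuous_at isCont_def)
    then have "((\<lambda>x. gap x k) \<longlongrightarrow> gap (pure_point G p) k) (nhds (pure_point G p))"
      by (simp only: tendsto_at_iff_tendsto_nhds[of "\<lambda>x. gap x k"])
    ultimately show "\<forall>\<^sub>F x in nhds (pure_point G p). c < gap x k" by (simp add: order_tendstoD)
  qed
  then obtain \<delta> where \<delta>: "0 < \<delta>" "\<And>x k. dist x (pure_point G p) < \<delta> \<Longrightarrow> k \<in> K \<Longrightarrow> c < gap x k"
    unfolding eventually_nhds_metric by blast
  \<comment> \<open>Coordinatewise distance at most \<rho> forces norm distance below \<delta>; the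
    bound 1 / 2 serves \<open>pure_nash_attracts\<close>.\<close>
  define \<rho> where "\<rho> = min (1 / 2) (\<delta> / (2 * real (CARD('i) * CARD('s))))"
  have N: "0 < real (CARD('i) * CARD('s))" by simp
  have \<rho>: "0 < \<rho>" "\<rho> \<le> 1 / 2" "real (CARD('i) * CARD('s)) * \<rho> < \<delta>"
  proof -
    show "0 < \<rho>" "\<rho> \<le> 1 / 2" using \<delta>(1) N by (auto simp: \<rho>_def simp del: of_nat_mult)
    have "real (CARD('i) * CARD('s)) * \<rho> \<le> real (CARD('i) * CARD('s)) * (\<delta> / (2 * real (CARD('i) * CARD('s))))"
      by (intro mult_left_mono) (auto simp: \<rho>_def)
    also have "\<dots> = \<delta> / 2" using N by (simp del: of_nat_mult)
    finally show "real (CARD('i) * CARD('s)) * \<rho> < \<delta>" using \<delta>(1) by linarith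
  qed
  have "c * (1 - x $ i $ p i) \<le> growth i (p i) x"
    if x: "x \<in> X" and i: "i \<in> I" and near: "\<And>j. j \<in> I \<Longrightarrow> 1 - \<rho> \<le> x $ j $ p j" for x i
  proof -
    have "\<bar>(x - pure_point G p) $ j $ s\<bar> \<le> \<rho>" for j s
    proof (cases "j \<in> I \<and> s \<in> S j")
      case True
      have "x $ j $ s \<le> 1 - x $ j $ p j" if "s \<noteq> p j"
      proof -
        have "(\<Sum>l\<in>{s, p j}. x $ j $ l) \<le> (\<Sum>l\<in>S j. x $ j $ l)"
          using True pi[of j] X_D(1)[OF x] by (intro sum_mono2) auto
        then show ?thesis using that X_D(3)[OF x] True by simp
      qed
      then show ?thesis
        using True near[of j] X_D(1,2)[OF x, of j s] by (auto simp: pure_point_def)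
    next
      case False
      then show ?thesis using X_D(4)[OF x, of j s] \<rho>(1) pi[of j] by (auto simp: pure_point_def)
    qed
    then have "dist x (pure_point G p) < \<delta>"
      using norm_le_coord_bound[of "x - pure_point G p" \<rho>] \<rho>(3) by (simp add: dist_norm)
    then have gap: "c \<le> D i (p i) x - D i s x" if "s \<in> S i - {p i}" for s
      using \<delta>(2)[of x "(i, s)"] that i by (auto simp: gap_def K_def)
    have "growth i (p i) x = (\<Sum>s\<in>S i. x $ i $ s * (D i (p i) x - D i s x))"
      using X_D(3)[OF x i] by (simp add: growth_def right_diff_distrib sum_subtractf flip: sum_distrib_right)
    also have "\<dots> = (\<Sum>s\<in>S i - {p i}. x $ i $ s * (D i (p i) x - D i s x))"
      using pi[OF i] by (subst sum.remove[of _ "p i"]) auto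
    also have "\<dots> \<ge> (\<Sum>s\<in>S i - {p i}. x $ i $ s * c)"
      using gap X_D(1)[OF x] by (intro sum_mono mult_left_mono) auto
    finally show ?thesis
      using X_D(3)[OF x i] pi[OF i]
      by (simp add: sum_diff1 right_diff_distrib mult.commute[of _ c] flip: sum_distrib_left)
  qed
  with c \<rho>(1,2) show thesis by (rule that)
qed

text \<open>Near \<open>p\<close> each \<open>p i\<close> has probability at least 1 / 2, so
  \<open>growth_pure_nash\<close> with constant \<open>c\<close> yields decay of the deficit
  \<open>1 - x $ i $ p i\<close> at rate \<open>c / 2\<close>.\<close>

lemma pure_nash_attracts:
  assumes "strict_game G" "pure_nash G p"
  obtains k \<rho> where "0 < k" "0 < \<rho>"
    "\<And>x t i. x \<in> X \<Longrightarrow> (\<And>j. j \<in> I \<Longrightarrow> 1 - \<rho> < x $ j $ p j) \<Longrightarrow> 0 \<le> t \<Longrightarrow> i \<in> I \<Longrightarrow>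
      1 - \<phi> x t $ i $ p i \<le> (1 - x $ i $ p i) * exp (- k * t)"
proof -
  obtain c \<rho> where c: "0 < c" "0 < \<rho>" "\<rho> \<le> 1 / 2"
    "\<And>x i. x \<in> X \<Longrightarrow> i \<in> I \<Longrightarrow> (\<And>j. j \<in> I \<Longrightarrow> 1 - \<rho> \<le> x $ j $ p j) \<Longrightarrow>
      c * (1 - x $ i $ p i) \<le> growth i (p i) x"
    by (rule growth_pure_nash[OF assms]) blast
  have "1 - \<phi> x t $ i $ p i \<le> (1 - x $ i $ p i) * exp (- (c / 2) * t)"
    if x: "x \<in> X" and near: "\<And>j. j \<in> I \<Longrightarrow> 1 - \<rho> < x $ j $ p j" and "0 \<le> t" and i: "i \<in> I" for x t i
  proof -
    have cont: "continuous_on A (\<lambda>t. \<phi> x t $ j $ s)" for A j s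
      by (intro continuous_on_component continuous_flow[OF x])
    have deriv: "\<exists>d. ((\<lambda>t. \<phi> x t $ j $ p j) has_real_derivative d) (at t) \<and> c / 2 * (1 - \<phi> x t $ j $ p j) \<le> d"
      if "j \<in> I" and "\<And>j. j \<in> I \<Longrightarrow> 1 - \<rho> < \<phi> x t $ j $ p j" for j t
    proof -
      let ?y = "\<phi> x t $ j $ p j"
      have "1 / 2 \<le> ?y" "?y \<le> 1" using that(2)[OF that(1)] c(3) X_D(2)[OF flow_in[OF x]] by auto
      then have "1 / 2 * (c * (1 - ?y)) \<le> ?y * (c * (1 - ?y))"
        using c(1) by (intro mult_right_mono) auto
      also have "\<dots> \<le> ?y * growth j (p j) (\<phi> x t)"
        using c(4)[OF flow_in[OF x] that(1), of t] that(2) X_D(1)[OF flow_in[OF x]]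
        by (intro mult_left_mono) (auto intro: less_imp_le)
      finally show ?thesis using coord_deriv[OF x, of j "p j" t] by auto
    qed
    \<comment> \<open>At the first exit time \<open>Inf B\<close> some coordinate would be at most
      \<open>1 - \<rho>\<close>, although it started above this value and has not decreased
      before.\<close>
    have stays: "1 - \<rho> < \<phi> x t $ j $ p j" if "0 \<le> t" "j \<in> I" for j t
    proof (rule ccontr)
      assume exit: "\<not> 1 - \<rho> < \<phi> x t $ j $ p j"
      define B where "B = (\<Union>j\<in>I. {u \<in> {0..t}. \<phi> x u $ j $ p j \<le> 1 - \<rho>})"
      have "closed B" unfolding B_def
        by (intro closed_UN finite ballI continuous_on_closed_Collect_le cont continuous_on_const
            closed_atLeastAtMost)
      moreover have "t \<in> B" using exit that by (auto simp: B_def not_less intro!: bexI[of _ j])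
      moreover have "bdd_below B" by (auto simp: B_def bdd_below_def)
      ultimately have B: "Inf B \<in> B" "\<And>u. u \<in> B \<Longrightarrow> Inf B \<le> u"
        by (auto intro: closed_contains_Inf cInf_lower)
      then obtain l where l: "l \<in> I" "0 \<le> Inf B" "Inf B \<le> t" "\<phi> x (Inf B) $ l $ p l \<le> 1 - \<rho>"
        by (auto simp: B_def)
      have "\<phi> x 0 $ l $ p l \<le> \<phi> x (Inf B) $ l $ p l"
      proof (rule DERIV_nonneg_imp_increasing_open[OF l(2)])
        fix u assume u: "0 < u" "u < Inf B"
        then have "u \<notin> B" using B(2)[of u] by auto
        then have "1 - \<rho> < \<phi> x u $ j $ p j" if "j \<in> I" for j
          using that u l by (auto simp: B_def not_le)
        from deriv[OF l(1) this] obtain d where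
          d: "((\<lambda>t. \<phi> x t $ l $ p l) has_real_derivative d) (at u)" "c / 2 * (1 - \<phi> x u $ l $ p l) \<le> d"
          by blast
        moreover have "0 \<le> c / 2 * (1 - \<phi> x u $ l $ p l)"
          using c(1) X_D(2)[OF flow_in[OF x]] by auto
        ultimately show "\<exists>d. ((\<lambda>t. \<phi> x t $ l $ p l) has_real_derivative d) (at u) \<and> 0 \<le> d"
          by (meson order_trans)
      qed (rule cont)
      then show False using near[OF l(1)] l(4) flow_0[OF x] by simp
    qed
    \<comment> \<open>Gronwall argument: the deficit times \<open>exp (c / 2 * t)\<close> is
      nonincreasing.\<close>
    have "(1 - \<phi> x t $ i $ p i) * exp (c / 2 * t) \<le> (1 - \<phi> x 0 $ i $ p i) * exp (c / 2 * 0)"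
    proof (rule DERIV_nonpos_imp_nonincreasing[OF \<open>0 \<le> t\<close>])
      fix u assume "0 \<le> u" "u \<le> t"
      then obtain d where d: "((\<lambda>t. \<phi> x t $ i $ p i) has_real_derivative d) (at u)"
          "c / 2 * (1 - \<phi> x u $ i $ p i) \<le> d"
        using deriv[OF i stays[of u]] by blast
      have "((\<lambda>t. (1 - \<phi> x t $ i $ p i) * exp (c / 2 * t)) has_real_derivative
          (c / 2 * (1 - \<phi> x u $ i $ p i) - d) * exp (c / 2 * u)) (at u)"
        using d(1) by (auto intro!: derivative_eq_intros simp: algebra_simps)
      moreover have "(c / 2 * (1 - \<phi> x u $ i $ p i) - d) * exp (c / 2 * u) \<le> 0"
        using d(2) by (intro mult_nonpos_nonneg) auto
      ultimately show "\<exists>d. ((\<lambda>t. (1 - \<phi> x t $ i $ p i) * exp (c / 2 * t)) has_real_derivative d) (at u) \<and> d \<le> 0"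
        by blast
    qed
    then show ?thesis using flow_0[OF x] by (simp add: exp_minus field_simps)
  qed
  then show thesis using that[of "c / 2" \<rho>] c(1,2) by auto
qed

text \<open>The set where all deficits \<open>1 - x $ i $ p i\<close> are below \<open>r\<close>
  traps chains: flowing for time at least 1 brings them to at most \<open>r * q\<close>, and a jump
  adds less than \<open>r * (1 - q)\<close>. Letting \<open>r\<close> tend to 0 leaves only the
  equilibrium.\<close>

lemma pseudo_orbit_from_nash:
  assumes "strict_game G" "pure_nash G p" and z: "pseudo_orbit X \<phi> (pure_point G p) z"
  shows "z = pure_point G p"
proof -
  obtain k \<rho> where k: "0 < k" "0 < \<rho>"
    "\<And>x t i. x \<in> X \<Longrightarrow> (\<And>j. j \<in> I \<Longrightarrow> 1 - \<rho> < x $ j $ p j) \<Longrightarrow> 0 \<le> t \<Longrightarrow> i \<in> I \<Longrightarrow>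
      1 - \<phi> x t $ i $ p i \<le> (1 - x $ i $ p i) * exp (- k * t)"
    by (rule pure_nash_attracts[OF assms(1,2)]) blast
  have p: "p \<in> profiles G" using assms(2) by (simp add: pure_nash_def)
  have close: "1 - r < z $ i $ p i" if r: "0 < r" "r < \<rho>" and i: "i \<in> I" for r i
  proof -
    define q where "q = exp (- k)"
    have q: "0 < q" "q < 1" using k(1) by (auto simp: q_def)
    have "chain X \<phi> (r * (1 - q)) 1 (pure_point G p) z"
      using z r q by (auto simp: pseudo_orbit_def)
    then have ch: "(chain_step X \<phi> (r * (1 - q)) 1)\<^sup>+\<^sup>+ (pure_point G p) z" by (simp add: chain_iff_tranclp)
    have step: "\<forall>i\<in>I. 1 - r < y $ i $ p i"
      if s: "chain_step X \<phi> (r * (1 - q)) 1 x y" and x: "\<forall>i\<in>I. 1 - r < x $ i $ p i" for x y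
    proof
      fix i assume i: "i \<in> I"
      obtain t where t: "x \<in> X" "1 \<le> t" "dist (\<phi> x t) y < r * (1 - q)" using s by (auto simp: chain_step_def)
      have "1 - \<phi> x t $ i $ p i \<le> (1 - x $ i $ p i) * exp (- k * t)"
        using t x r i by (intro k(3)) force+
      also have "\<dots> \<le> r * q"
        using x i t k(1) r X_D(2)[OF t(1)] by (intro mult_mono) (auto simp: q_def intro: less_imp_le)
      finally have "1 - \<phi> x t $ i $ p i \<le> r * q" .
      moreover have "\<phi> x t $ i $ p i - y $ i $ p i \<le> dist (\<phi> x t) y"
        using abs_coord_le_norm[of "\<phi> x t - y" i "p i"] by (simp add: dist_norm)
      ultimately show "1 - r < y $ i $ p i" using t(3) by (simp add: algebra_simps)
    qed
    from ch have "\<forall>i\<in>I. 1 - r < z $ i $ p i"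
    proof (induction rule: tranclp_induct)
      case (base y)
      have "\<forall>i\<in>I. 1 - r < pure_point G p $ i $ p i" using r by (simp add: pure_point_def)
      then show ?case by (rule step[OF base])
    qed (use step in blast)
    then show ?thesis using i by blast
  qed
  have "chain X \<phi> 1 1 (pure_point G p) z" using z by (simp add: pseudo_orbit_def)
  then have "z \<in> X" by (rule chain_in)
  moreover have "1 \<le> z $ i $ p i" if "i \<in> I" for i
  proof (rule field_le_epsilon)
    fix e :: real assume "0 < e"
    then have "1 - min e (\<rho> / 2) < z $ i $ p i" using k(2) that by (intro close) auto
    then show "1 \<le> z $ i $ p i + e" by linarith
  qed
  ultimately show ?thesis using p by (intro eq_pure_pointI) auto
qed

lemma chain_recurrent_pure_point: "p \<in> profiles G \<Longrightarrow> chain_recurrent X \<phi> (pure_point G p)"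
  by (simp add: chain_recurrent_def chain_equivalent_def pseudo_orbit_def chain_pure_point_refl)

end

section \<open>Identification of the sink chain components\<close>

theorem theorem5p6:
  fixes G :: "('i::finite, 's::finite) game"
    and \<phi> :: "real^'s^'i \<Rightarrow> real \<Rightarrow> real^'s^'i"
  assumes "finite_game G"
    and "strict_game G"
    and "preference_potential G"
    and "replicator_flow G \<phi>"
  shows "sink_chain_components (strategy_space G) \<phi> = {{pure_point G p} | p. pure_nash G p}"
proof -
  interpret replicator G \<phi> using assms(1,4) by unfold_locales
  obtain Q where Q: "ordinal_potential G Q"
    by (rule preference_potential_ordinal[OF assms(3)])
  let ?E = "{(x, y). chain_recurrent X \<phi> x \<and> chain_recurrent X \<phi> y \<and> chain_equivalent X \<phi> x y}"
  have nash_recurrent: "chain_recurrent X \<phi> (pure_point G p)" if "pure_nash G p" for p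
    using that by (intro chain_recurrent_pure_point) (simp add: pure_nash_def)
  \<comment> \<open>Pseudo-orbits from an equilibrium end at it, so its class has no other
    point.\<close>
  have nash_class: "?E `` {pure_point G p} = {pure_point G p}" if "pure_nash G p" for p
    using nash_recurrent[OF that] pseudo_orbit_from_nash[OF assms(2) that]
    by (auto simp: chain_recurrent_def chain_equivalent_def)
  show ?thesis
  proof (intro subset_antisym subsetI)
    fix C assume "C \<in> sink_chain_components X \<phi>"
    then obtain c where c: "chain_recurrent X \<phi> c" "C = ?E `` {c}"
        and sink: "\<And>y z. y \<in> C \<Longrightarrow> chain_recurrent X \<phi> z \<Longrightarrow> pseudo_orbit X \<phi> y z \<Longrightarrow> z \<in> C"
      by (auto simp: sink_chain_components_def chain_components_def quotient_def)
    have "c \<in> X"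
      using c(1) chain_in(1)[of X \<phi> 1 1 c c]
      by (auto simp: chain_recurrent_def chain_equivalent_def pseudo_orbit_def)
    \<comment> \<open>Being a sink, \<open>C\<close> contains the equilibrium reached from
      \<open>c\<close>; chain equivalence gives a pseudo-orbit back to \<open>c\<close>, which
      forces equality.\<close>
    then obtain p where p: "pure_nash G p" "pseudo_orbit X \<phi> c (pure_point G p)"
      by (rule pseudo_orbit_to_nash[OF Q])
    have "c \<in> C" using c by (auto simp: chain_recurrent_def)
    then have "pure_point G p \<in> C" using sink nash_recurrent p by blast
    then have "pseudo_orbit X \<phi> (pure_point G p) c" using c(2) by (auto simp: chain_equivalent_def)
    then have "c = pure_point G p" by (rule pseudo_orbit_from_nash[OF assms(2) p(1)])
    then show "C \<in> {{pure_point G p} | p. pure_nash G p}" using c(2) nash_class[OF p(1)] p(1) by auto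
  next
    fix C assume "C \<in> {{pure_point G p} | p. pure_nash G p}"
    then obtain p where p: "C = {pure_point G p}" "pure_nash G p" by blast
    have "?E `` {pure_point G p} \<in> chain_components X \<phi>"
      unfolding chain_components_def using nash_recurrent[OF p(2)] by (intro quotientI) simp
    then have "C \<in> chain_components X \<phi>" by (simp only: nash_class[OF p(2)] p(1))
    then show "C \<in> sink_chain_components X \<phi>"
      using pseudo_orbit_from_nash[OF assms(2) p(2)] by (auto simp: sink_chain_components_def p(1))
  qed
qed

end
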